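(* Let $k\ge2$ be an integer and let $Y$ be a real random variable such that there exists $\lambda<0$ with $\mathbb{E}[e^{\lambda Y}]<\infty$. Let $\varepsilon>0$ and let $\gamma=\inf\{z\le\mathbb{E}[Y]:\Lambda^\star(z)<\log k\}$. Then for any $\delta>0$ there exist constants $c,c'\in(0,\infty)$ such that, for all $m\ge1$, $$c\,k^m e^{-m(\Lambda^\star(\gamma-\varepsilon)+\delta)}\le\mathbb{P}\{M_m\le(\gamma-\varepsilon)m\}\le c'\,k^m e^{-m\Lambda^\star(\gamma-\varepsilon)},$$ where $M_m$ is the minimum position at level $m$ of the branching random walk with constant branching factor $k$ and step distribution $Y$.
   Context: $\log$ is the natural logarithm. Branching random walk with branching factor $k$ and step distribution $Y$: let $\mathcal{A}=\{1,\dots,k\}$ and let $\mathcal{U}=\bigcup_{m\ge0}\mathcal{A}^m$ be the set of finite words on $\mathcal{A}$, viewed as the complete $k$-ary tree, with $v\preceq u$ meaning that $v$ is a prefix of $u$. Let $Y_u$, $u\in\mathcal{U}\setminus\{\varnothing\}$, be i.i.d. copies of $Y$, and $Y_\varnothing=0$. The position of $u$ is $S_u=\sum_{v\preceq u}Y_v$, and $M_m=\min\{S_u:u\in\mathcal{A}^m\}$. $\Lambda(\lambda)=\log\mathbb{E}[e^{\lambda Y}]\in(-\infty,+\infty]$ for $\lambda\in\mathbb{R}$, and $\Lambda^\star(z)=\sup_{\lambda\in\mathbb{R}}\{\lambda z-\Lambda(\lambda)\}\in[0,+\infty]$, with the convention $e^{-\infty}=0$. The moment hypothesis makes $\mathbb{E}[Y]\in(-\infty,+\infty]$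 well defined. *)

theory Defs
  imports "HOL-Probability.Probability" "HOL-Library.Sublist"
begin

text \<open>The expectation of a random variable, with values in the extended reals. It is
  meaningful only if the positive or the negative part is integrable.\<close>

definition ext_expectation :: "'a measure \<Rightarrow> ('a \<Rightarrow> real) \<Rightarrow> ereal" where
  "ext_expectation N Y =
     enn2ereal (\<integral>\<^sup>+ \<omega>. ennreal (max 0 (Y \<omega>)) \<partial>N) - enn2ereal (\<integral>\<^sup>+ \<omega>. ennreal (max 0 (- Y \<omega>)) \<partial>N)"

definition log_mgf :: "'a measure \<Rightarrow> ('a \<Rightarrow> real) \<Rightarrow> real \<Rightarrow> ereal" where
  "log_mgf N Y \<theta> =
     (if integrable N (\<lambda>\<omega>. exp (\<theta> * Y \<omega>))
      then ereal (ln (\<integral>\<omega>. exp (\<theta> * Y \<omega>) \<partial>N)) else \<infinity>)"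

definition rate_function :: "'a measure \<Rightarrow> ('a \<Rightarrow> real) \<Rightarrow> real \<Rightarrow> ereal" where
  "rate_function N Y z = (SUP \<theta>::real. ereal (\<theta> * z) - log_mgf N Y \<theta>)"

text \<open>The infimum is taken in the reals. The set is nonempty and bounded below whenever
  \<open>exp (\<theta> * Y)\<close> is integrable for some \<open>\<theta> < 0\<close> and \<open>k \<ge> 2\<close>, so no default value
  of \<open>Inf\<close> enters.\<close>

definition brw_speed :: "nat \<Rightarrow> 'a measure \<Rightarrow> ('a \<Rightarrow> real) \<Rightarrow> real" where
  "brw_speed k N Y =
     Inf {z::real. ereal z \<le> ext_expectation N Y \<and> rate_function N Y z < ereal (ln (real k))}"

definition exp_ereal :: "ereal \<Rightarrow> ereal" where
  "exp_ereal x = (if x = \<infinity> then \<infinity> else if x = -\<infinity> then 0 else ereal (exp (real_of_ereal x)))"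

definition words :: "nat \<Rightarrow> nat list set" where
  "words k = {u. set u \<subseteq> {1..k}}"

text \<open>\<open>X\<close> is the family of displacements, living on a probability space \<open>M\<close> that need not be
  the space \<open>N\<close> on which the step variable \<open>Y\<close> is defined.\<close>

definition brw_displacements ::
  "nat \<Rightarrow> 'b measure \<Rightarrow> ('b \<Rightarrow> real) \<Rightarrow> 'a measure \<Rightarrow> (nat list \<Rightarrow> 'a \<Rightarrow> real) \<Rightarrow> bool" where
  "brw_displacements k N Y M X \<longleftrightarrow>
     prob_space M \<and>
     prob_space.indep_vars M (\<lambda>_. borel) X (words k - {[]}) \<and>
     (\<forall>u \<in> words k - {[]}. distr M borel (X u) = distr N borel Y) \<and>
     (\<forall>\<omega> \<in> space M. X [] \<omega> = 0)"

definition brw_position :: "(nat list \<Rightarrow> 'a \<Rightarrow> real) \<Rightarrow> nat list \<Rightarrow> 'a \<Rightarrow> real" where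
  "brw_position X u \<omega> = (\<Sum>v | prefix v u. X v \<omega>)"

definition brw_min :: "nat \<Rightarrow> (nat list \<Rightarrow> 'a \<Rightarrow> real) \<Rightarrow> nat \<Rightarrow> 'a \<Rightarrow> real" where
  "brw_min k X m \<omega> = Min ((\<lambda>u. brw_position X u \<omega>) ` {u \<in> words k. length u = m})"

end

theory Submission
  imports Defs
begin

text \<open>Write \<open>z = \<gamma> - \<epsilon>\<close> and \<open>I = rate_function N Y z\<close>; the choice of \<open>\<gamma>\<close> forces
  \<open>z \<le> E Y\<close> and \<open>I \<ge> ln k\<close>. The upper bound is a union bound and Chernoff's inequality.

  For the lower bound, Cramer's theorem gives a block length \<open>L\<close> such that a single path of length \<open>L\<close> ends
  below \<open>z * L\<close> with probability \<open>q \<ge> exp (- (I + \<delta> / 2)) ^ L\<close>. With \<open>p m\<close> the probability that the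
  minimum at level \<open>m\<close> is at most \<open>z * m\<close>, Bonferroni's inequality over the vertices of level \<open>L\<close> and the
  branching property yield \<open>p (L + m) \<ge> k ^ L * q * p m - (k ^ L * p m)\<^sup>2\<close>. Since
  \<open>k * exp (- (I + \<delta>)) < 1\<close>, iterating this recursion loses only a constant factor.

  The generating function of \<open>Y\<close> may be infinite on a half line and its infimum need not be a
  stationary point, so Cramer's bound is proved for the truncated variable, where
  \<open>\<phi>(t) = E (exp (t * W); \<bar>W\<bar> \<le> a)\<close> has a leftmost minimiser. Slightly to the left of it the exponentially
  tilted sum concentrates just below \<open>0\<close>; the two tails are controlled by \<open>\<phi>(t + s)\<close> and \<open>\<phi>(t - s)\<close>, so
  neither a change of measure nor a law of large numbers is needed.\<close>

subsection \<open>Truncated moment generating functions\<close>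

text \<open>Not normalised by the mass of the window, so the value increases with \<open>a\<close>.
  Truncation makes it finite and continuous in \<open>t\<close> whatever the tails of
  \<open>W\<close>.\<close>

definition trunc_mgf :: "'a measure \<Rightarrow> ('a \<Rightarrow> real) \<Rightarrow> real \<Rightarrow> real \<Rightarrow> real" where
  "trunc_mgf N W a t = (\<integral>\<omega>. indicator {-a..a} (W \<omega>) * exp (t * W \<omega>) \<partial>N)"

lemma trunc_exp_le:
  fixes x a t :: real
  shows "indicator {-a..a} x * exp (t * x) \<le> exp (\<bar>t\<bar> * \<bar>a\<bar>)"
proof (cases "x \<in> {-a..a}")
  case True
  then have "\<bar>x\<bar> \<le> \<bar>a\<bar>" by auto
  then have "\<bar>t\<bar> * \<bar>x\<bar> \<le> \<bar>t\<bar> * \<bar>a\<bar>"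
    by (intro mult_left_mono) auto
  moreover have "t * x \<le> \<bar>t\<bar> * \<bar>x\<bar>" by (metis abs_ge_self abs_mult)
  ultimately show ?thesis using True by simp
qed simp

text \<open>A minimum exists on the compact sublevel set of \<open>f 0\<close>. The set of
  minimisers is closed and bounded below, hence contains its infimum. Strictness to the left is what
  later makes a small step to the left increase the function.\<close>

lemma ex_leftmost_minimiser:
  fixes f :: "real \<Rightarrow> real"
  assumes cont: "continuous_on UNIV f" and bdd: "bounded {t. f t \<le> f 0}"
  shows "\<exists>t. (\<forall>s. f t \<le> f s) \<and> (\<forall>s<t. f t < f s)"
proof -
  have cl: "closed {t. f t \<le> C}" for C
    by (intro closed_Collect_le cont continuous_on_const)
  have "compact {t. f t \<le> f 0}" using cl bdd by (simp add: compact_eq_bounded_closed)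
  then obtain t0 where t0: "f t0 \<le> f 0" "\<And>s. f s \<le> f 0 \<Longrightarrow> f t0 \<le> f s"
    using continuous_attains_inf[of "{t. f t \<le> f 0}" f] continuous_on_subset[OF cont] by blast
  then have min: "f t0 \<le> f s" for s using t0(1) t0(2)[of s] by linarith
  let ?S = "{t. f t \<le> f t0}"
  have "?S \<subseteq> {t. f t \<le> f 0}" using t0(1) by auto
  then have bb: "bdd_below ?S" by (intro bounded_imp_bdd_below bounded_subset[OF bdd])
  have "Inf ?S \<in> ?S" by (rule closed_contains_Inf) (use bb cl in auto)
  moreover have "f s > f t0" if "s < Inf ?S" for s
    using cInf_lower[OF _ bb, of s] that by (auto simp: not_le[symmetric])
  ultimately show ?thesis using min by (intro exI[of _ "Inf ?S"]) (auto intro: le_less_trans order_trans)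
qed

text \<open>The quadratic error is what allows a step size \<open>s\<close> to beat a term linear in
  \<open>s\<close>. The bound on \<open>exp (- \<bar>x\<bar>)\<close> comes from
  \<open>1 / (1 + y) \<le> 1 - y + y\<^sup>2\<close>, where cross-multiplying leaves the surplus
  \<open>y ^ 3\<close>.\<close>

lemma cosh_le_one_plus_square:
  fixes x :: real
  assumes "\<bar>x\<bar> \<le> 1"
  shows "cosh x \<le> 1 + x\<^sup>2"
proof -
  have "exp \<bar>x\<bar> \<le> 1 + \<bar>x\<bar> + \<bar>x\<bar>\<^sup>2" using exp_bound[of "\<bar>x\<bar>"] assms by simp
  moreover have "exp (- \<bar>x\<bar>) \<le> 1 - \<bar>x\<bar> + \<bar>x\<bar>\<^sup>2"
  proof -
    have "1 / exp \<bar>x\<bar> \<le> 1 / (1 + \<bar>x\<bar>)"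
      using exp_ge_add_one_self[of "\<bar>x\<bar>"] by (intro divide_left_mono) auto
    also have "\<dots> \<le> 1 - \<bar>x\<bar> + \<bar>x\<bar>\<^sup>2"
    proof -
      have "(1 - y + y\<^sup>2) * (1 + y) = 1 + y ^ 3" for y :: real
        by (simp add: algebra_simps power2_eq_square power3_eq_cube)
      from this[of "\<bar>x\<bar>"] show ?thesis by (simp add: divide_le_eq)
    qed
    finally show ?thesis by (simp add: exp_minus inverse_eq_divide)
  qed
  ultimately have "cosh \<bar>x\<bar> \<le> 1 + \<bar>x\<bar>\<^sup>2" by (simp add: cosh_def)
  then show ?thesis by simp
qed

context prob_space
begin

lemma trunc_exp_integrable:
  fixes a t :: real
  assumes [measurable]: "W \<in> borel_measurable M"
  shows "integrable M (\<lambda>\<omega>. indicator {-a..a} (W \<omega>) * exp (t * W \<omega>))"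
proof (rule integrable_const_bound[where B = "exp (\<bar>t\<bar> * \<bar>a\<bar>)"])
  show "AE \<omega> in M. norm (indicator {-a..a} (W \<omega>) * exp (t * W \<omega>)) \<le> exp (\<bar>t\<bar> * \<bar>a\<bar>)"
    using trunc_exp_le[of a _ t] by (intro AE_I2) (simp add: abs_mult)
qed measurable

lemma trunc_mgf_nonneg: "trunc_mgf M W a t \<ge> 0"
  unfolding trunc_mgf_def by (intro integral_nonneg_AE AE_I2) simp

lemma trunc_mgf_mono:
  assumes "W \<in> borel_measurable M" "a \<le> b"
  shows "trunc_mgf M W a t \<le> trunc_mgf M W b t"
  unfolding trunc_mgf_def using assms
  by (intro integral_mono trunc_exp_integrable) (auto split: split_indicator)

lemma continuous_trunc_mgf:
  assumes [measurable]: "W \<in> borel_measurable M"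
  shows "continuous_on UNIV (trunc_mgf M W a)"
proof -
  have "(\<lambda>n. trunc_mgf M W a (u n)) \<longlonglongrightarrow> trunc_mgf M W a t" if u: "u \<longlonglongrightarrow> t" for u t
  proof -
    obtain C where C: "\<And>n. \<bar>u n\<bar> \<le> C"
      using convergent_imp_Bseq[OF convergentI[OF u]] unfolding Bseq_def by auto
    show ?thesis
      unfolding trunc_mgf_def
    proof (rule integral_dominated_convergence[where w = "\<lambda>_. exp (C * \<bar>a\<bar>)"])
      show "AE \<omega> in M. norm (indicator {-a..a} (W \<omega>) * exp (u n * W \<omega>)) \<le> exp (C * \<bar>a\<bar>)" for n
      proof (rule AE_I2)
        fix \<omega>
        have "indicator {-a..a} (W \<omega>) * exp (u n * W \<omega>) \<le> exp (\<bar>u n\<bar> * \<bar>a\<bar>)"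
          by (rule trunc_exp_le)
        also have "\<dots> \<le> exp (C * \<bar>a\<bar>)" using C[of n] by (simp add: mult_right_mono)
        finally show "norm (indicator {-a..a} (W \<omega>) * exp (u n * W \<omega>)) \<le> exp (C * \<bar>a\<bar>)"
          by (simp add: abs_mult)
      qed
      show "AE \<omega> in M. (\<lambda>n. indicator {-a..a} (W \<omega>) * exp (u n * W \<omega>))
          \<longlonglongrightarrow> indicator {-a..a} (W \<omega>) * exp (t * W \<omega>)"
        by (intro AE_I2 tendsto_mult tendsto_const tendsto_exp u)
    qed simp_all
  qed
  then show ?thesis
    by (auto simp: continuous_on_sequentially o_def)
qed

lemma trunc_mgf_ge:
  assumes [measurable]: "W \<in> borel_measurable M"
    and "b > 0" "b \<le> a" "t \<ge> 0"
  shows "trunc_mgf M W a t \<ge> prob {\<omega> \<in> space M. W \<omega> \<in> {b..a}} * exp (t * b)"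
proof -
  have "prob {\<omega> \<in> space M. W \<omega> \<in> {b..a}} * exp (t * b)
      = (\<integral>\<omega>. indicator {\<omega> \<in> space M. W \<omega> \<in> {b..a}} \<omega> * exp (t * b) \<partial>M)"
    by (simp add: measure_def)
  also have "\<dots> \<le> trunc_mgf M W a t"
    unfolding trunc_mgf_def using assms
    by (intro integral_mono trunc_exp_integrable integrable_mult_left)
       (auto simp: integrable_real_indicator emeasure_eq_measure mult_left_mono split: split_indicator)
  finally show ?thesis .
qed

lemma trunc_mgf_uminus:
  "trunc_mgf M (\<lambda>\<omega>. - W \<omega>) a t = trunc_mgf M W a (- t)"
  unfolding trunc_mgf_def by (intro Bochner_Integration.integral_cong) (auto split: split_indicator)

text \<open>On the window, \<open>cosh (h * x) \<le> cosh (h * a)\<close>. This stands in for a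
  bound on the second derivative: if \<open>t\<close> is a minimiser, it bounds the value at
  \<open>t - h\<close> by a multiple of the minimum that is close to one.\<close>

lemma trunc_mgf_add_le:
  assumes [measurable]: "W \<in> borel_measurable M"
  shows "trunc_mgf M W a (t + h) + trunc_mgf M W a (t - h) \<le> 2 * cosh (h * a) * trunc_mgf M W a t"
proof -
  have pt: "indicator {-a..a} x * exp ((t + h) * x) + indicator {-a..a} x * exp ((t - h) * x)
      \<le> 2 * cosh (h * a) * (indicator {-a..a} x * exp (t * x))" for x :: real
  proof (cases "x \<in> {-a..a}")
    case True
    then have "\<bar>x\<bar> \<le> \<bar>a\<bar>" by auto
    then have "\<bar>h * x\<bar> \<le> \<bar>h * a\<bar>" by (auto simp: abs_mult intro: mult_left_mono)
    then have "cosh \<bar>h * x\<bar> \<le> cosh \<bar>h * a\<bar>" by (subst cosh_real_nonneg_le_iff) auto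
    then have "cosh (h * x) \<le> cosh (h * a)" by simp
    then have "2 * cosh (h * x) * exp (t * x) \<le> 2 * cosh (h * a) * exp (t * x)" by simp
    moreover have "2 * cosh (h * x) * exp (t * x) = exp ((t + h) * x) + exp ((t - h) * x)"
      by (simp add: cosh_def algebra_simps flip: exp_add)
    ultimately show ?thesis using True by simp
  qed simp
  have "trunc_mgf M W a (t + h) + trunc_mgf M W a (t - h)
     = (\<integral>\<omega>. indicator {-a..a} (W \<omega>) * exp ((t + h) * W \<omega>) + indicator {-a..a} (W \<omega>) * exp ((t - h) * W \<omega>) \<partial>M)"
    unfolding trunc_mgf_def by (intro Bochner_Integration.integral_add[symmetric] trunc_exp_integrable assms)
  also have "\<dots> \<le> (\<integral>\<omega>. 2 * cosh (h * a) * (indicator {-a..a} (W \<omega>) * exp (t * W \<omega>)) \<partial>M)"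
    by (intro integral_mono Bochner_Integration.integrable_add integrable_mult_right trunc_exp_integrable assms pt)
  finally show ?thesis by (simp add: trunc_mgf_def)
qed

text \<open>The event \<open>W > 0\<close> is the union of the events that \<open>W\<close> lies
  between \<open>1 / (n + 1)\<close> and \<open>n + 1\<close>, so these cannot all be null. Raising
  the upper end to \<open>m\<close> only enlarges the event.\<close>

lemma ex_prob_Icc_pos:
  assumes [measurable]: "W \<in> borel_measurable M" and pos: "prob {\<omega> \<in> space M. W \<omega> > 0} > 0"
  shows "\<exists>n::nat. n > 0 \<and> (\<forall>m\<ge>n. prob {\<omega> \<in> space M. W \<omega> \<in> {1 / real n..real m}} > 0)"
proof (rule ccontr)
  assume neg: "\<not> ?thesis"
  have "emeasure M {\<omega> \<in> space M. W \<omega> \<in> {1 / real (Suc n)..real (Suc n)}} = 0" for n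
  proof -
    obtain m where m: "m \<ge> Suc n" "\<not> prob {\<omega> \<in> space M. W \<omega> \<in> {1 / real (Suc n)..real m}} > 0"
      using neg by blast
    have "prob {\<omega> \<in> space M. W \<omega> \<in> {1 / real (Suc n)..real (Suc n)}}
        \<le> prob {\<omega> \<in> space M. W \<omega> \<in> {1 / real (Suc n)..real m}}"
      using m(1) by (intro finite_measure_mono) auto
    then show ?thesis using m(2) by (simp add: emeasure_eq_measure not_less measure_le_0_iff)
  qed
  then have "emeasure M (\<Union>n. {\<omega> \<in> space M. W \<omega> \<in> {1 / real (Suc n)..real (Suc n)}}) = 0"
    by (intro emeasure_UN_eq_0) auto
  moreover have "emeasure M {\<omega> \<in> space M. W \<omega> > 0} \<le> emeasure M (\<Union>n. {\<omega> \<in> space M. W \<omega> \<in> {1 / real (Suc n)..real (Suc n)}})"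
  proof (rule emeasure_mono, safe)
    fix \<omega> assume w: "\<omega> \<in> space M" "W \<omega> > 0"
    obtain n where n: "real n \<ge> W \<omega>" using real_arch_simple by blast
    obtain l where l: "l > 0" "inverse (real l) < W \<omega>"
      using ex_inverse_of_nat_less[OF w(2)] by blast
    have "1 / real (Suc (n + l)) \<le> inverse (real l)"
      using l(1) by (simp add: field_simps)
    then show "\<omega> \<in> (\<Union>n. {\<omega> \<in> space M. W \<omega> \<in> {1 / real (Suc n)..real (Suc n)}})"
      using w n l by (intro UN_I[of "n + l"]) auto
  qed measurable
  ultimately show False using pos by (simp add: emeasure_eq_measure)
qed

text \<open>Positive mass at distance at least \<open>1 / n\<close> to the right of the origin
  forces growth at least linear in \<open>t\<close>. The threshold \<open>n\<close> is uniform,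
  while the bound \<open>B\<close> may depend on \<open>m\<close>.\<close>

lemma trunc_mgf_coercive:
  assumes [measurable]: "W \<in> borel_measurable M" and pos: "prob {\<omega> \<in> space M. W \<omega> > 0} > 0"
  shows "\<exists>n. \<forall>m\<ge>n. \<exists>B. \<forall>t. trunc_mgf M W (real m) t \<le> C \<longrightarrow> t \<le> B"
proof -
  obtain n :: nat where n: "n > 0" "\<And>m. m \<ge> n \<Longrightarrow> prob {\<omega> \<in> space M. W \<omega> \<in> {1 / real n..real m}} > 0"
    using ex_prob_Icc_pos[OF assms] by blast
  show ?thesis
  proof (intro exI[of _ n] allI impI)
    fix m assume m: "m \<ge> n"
    let ?q = "prob {\<omega> \<in> space M. W \<omega> \<in> {1 / real n..real m}}"
    have "1 / real n \<le> 1" using n(1) by simp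
    also have "1 \<le> real m" using n(1) m by simp
    finally have le: "1 / real n \<le> real m" .
    show "\<exists>B. \<forall>t. trunc_mgf M W (real m) t \<le> C \<longrightarrow> t \<le> B"
    \<comment> \<open>For nonnegative \<open>t\<close> the inequality
      \<open>?q * t / n \<le> C\<close> gives the second entry; the \<open>0\<close> covers negative
      \<open>t\<close>.\<close>
    proof (intro exI[of _ "max 0 (C / ?q * real n)"] allI impI)
      fix t assume t: "trunc_mgf M W (real m) t \<le> C"
      show "t \<le> max 0 (C / ?q * real n)"
      proof (cases "t \<ge> 0")
        case True
        have "?q * (t * (1 / real n)) \<le> ?q * exp (t * (1 / real n))"
          using exp_ge_add_one_self[of "t * (1 / real n)"]
          by (intro mult_left_mono measure_nonneg) linarith
        also have "\<dots> \<le> C"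
          using trunc_mgf_ge[of W "1 / real n" "real m" t] n(1) le True t by simp
        finally have "t \<le> C / ?q * real n"
          using n(1) n(2)[OF m] by (simp add: field_simps)
        then show ?thesis by simp
      qed simp
    qed
  qed
qed

text \<open>Coercivity for \<open>W\<close> bounds the sublevel set above; applied to
  \<open>- W\<close>, which reflects the parameter, it bounds it below.\<close>

lemma trunc_mgf_sublevel_bounded:
  assumes [measurable]: "W \<in> borel_measurable M"
    and "prob {\<omega> \<in> space M. W \<omega> > 0} > 0" "prob {\<omega> \<in> space M. W \<omega> < 0} > 0"
  shows "\<exists>n. \<forall>m\<ge>n. bounded {t. trunc_mgf M W (real m) t \<le> C}"
proof -
  obtain n1 where n1: "\<And>m. m \<ge> n1 \<Longrightarrow> \<exists>B. \<forall>t. trunc_mgf M W (real m) t \<le> C \<longrightarrow> t \<le> B"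
    using trunc_mgf_coercive[of W C] assms by blast
  obtain n2 where n2: "\<And>m. m \<ge> n2 \<Longrightarrow> \<exists>B. \<forall>t. trunc_mgf M (\<lambda>\<omega>. - W \<omega>) (real m) t \<le> C \<longrightarrow> t \<le> B"
    using trunc_mgf_coercive[of "\<lambda>\<omega>. - W \<omega>" C] assms by auto
  show ?thesis
  proof (intro exI[of _ "max n1 n2"] allI impI)
    fix m assume m: "m \<ge> max n1 n2"
    obtain B1 where B1: "\<And>t. trunc_mgf M W (real m) t \<le> C \<Longrightarrow> t \<le> B1"
      using n1[of m] m by auto
    obtain B2 where B2: "\<And>t. trunc_mgf M W (real m) t \<le> C \<Longrightarrow> - t \<le> B2"
      using n2[of m] m unfolding trunc_mgf_uminus by (metis add.inverse_inverse max.bounded_iff)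
    have "{t. trunc_mgf M W (real m) t \<le> C} \<subseteq> {-B2..B1}" using B1 B2 by force
    then show "bounded {t. trunc_mgf M W (real m) t \<le> C}"
      using bounded_closed_interval bounded_subset by blast
  qed
qed

text \<open>Monotone convergence along growing windows: a uniform bound on the truncated integrals
  yields both integrability and the bound for the limit.\<close>

lemma integrable_exp_of_trunc_mgf_le:
  assumes [measurable]: "W \<in> borel_measurable M"
    and le: "\<And>n. trunc_mgf M W (real n) t \<le> C"
  shows "integrable M (\<lambda>\<omega>. exp (t * W \<omega>))" "(\<integral>\<omega>. exp (t * W \<omega>) \<partial>M) \<le> C"
proof -
  have C: "C \<ge> 0" using le[of 0] trunc_mgf_nonneg[of W 0 t] by simp
  have "(\<integral>\<^sup>+\<omega>. ennreal (exp (t * W \<omega>)) \<partial>M)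
      = (\<integral>\<^sup>+\<omega>. (SUP n. ennreal (indicator {-real n..real n} (W \<omega>) * exp (t * W \<omega>))) \<partial>M)"
  proof (rule nn_integral_cong, rule antisym)
    fix \<omega>
    obtain n where "real n \<ge> \<bar>W \<omega>\<bar>" using real_arch_simple by blast
    then show "ennreal (exp (t * W \<omega>)) \<le> (SUP n. ennreal (indicator {-real n..real n} (W \<omega>) * exp (t * W \<omega>)))"
      by (intro SUP_upper2[of n]) (auto simp: abs_le_iff indicator_def)
    show "(SUP n. ennreal (indicator {-real n..real n} (W \<omega>) * exp (t * W \<omega>))) \<le> ennreal (exp (t * W \<omega>))"
      by (intro SUP_least ennreal_leI) (auto split: split_indicator)
  qed
  also have "\<dots> = (SUP n. \<integral>\<^sup>+\<omega>. ennreal (indicator {-real n..real n} (W \<omega>) * exp (t * W \<omega>)) \<partial>M)"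
    by (intro nn_integral_monotone_convergence_SUP)
       (auto simp: incseq_def le_fun_def split: split_indicator intro!: ennreal_leI)
  also have "\<dots> \<le> ennreal C"
  proof (rule SUP_least)
    fix n :: nat
    have "(\<integral>\<^sup>+\<omega>. ennreal (indicator {-real n..real n} (W \<omega>) * exp (t * W \<omega>)) \<partial>M)
       = ennreal (trunc_mgf M W (real n) t)"
      unfolding trunc_mgf_def by (intro nn_integral_eq_integral trunc_exp_integrable) auto
    also have "\<dots> \<le> ennreal C" by (intro ennreal_leI le)
    finally show "(\<integral>\<^sup>+\<omega>. ennreal (indicator {-real n..real n} (W \<omega>) * exp (t * W \<omega>)) \<partial>M) \<le> ennreal C" .
  qed
  finally have *: "(\<integral>\<^sup>+\<omega>. ennreal (exp (t * W \<omega>)) \<partial>M) \<le> ennreal C" .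
  show int: "integrable M (\<lambda>\<omega>. exp (t * W \<omega>))"
    using * by (intro integrableI_nonneg) (auto simp: less_top[symmetric] top_unique)
  show "(\<integral>\<omega>. exp (t * W \<omega>) \<partial>M) \<le> C"
    using * C by (simp add: nn_integral_eq_integral[OF int])
qed

text \<open>The compact sublevel sets of the truncated generating functions decrease; a common
  point would be a parameter at which the untruncated generating function is at most \<open>r\<close>.\<close>

lemma ex_trunc_mgf_gt:
  assumes [measurable]: "W \<in> borel_measurable M"
    and "prob {\<omega> \<in> space M. W \<omega> > 0} > 0" "prob {\<omega> \<in> space M. W \<omega> < 0} > 0"
    and gt: "\<And>t. integrable M (\<lambda>\<omega>. exp (t * W \<omega>)) \<Longrightarrow> (\<integral>\<omega>. exp (t * W \<omega>) \<partial>M) > r"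
  shows "\<exists>n0. \<forall>n\<ge>n0. \<forall>t. trunc_mgf M W (real n) t > r"
proof (rule ccontr)
  assume neg: "\<not> ?thesis"
  obtain n0 where n0: "\<And>m. m \<ge> n0 \<Longrightarrow> bounded {t. trunc_mgf M W (real m) t \<le> r}"
    using trunc_mgf_sublevel_bounded[of W r] assms by blast
  have anti: "{t. trunc_mgf M W (real n) t \<le> r} \<subseteq> {t. trunc_mgf M W (real m) t \<le> r}" if "m \<le> n" for m n
    using trunc_mgf_mono[of W "real m" "real n"] that by (auto intro: order_trans)
  have cl: "closed {t. trunc_mgf M W (real (n0 + n)) t \<le> r}" for n
    by (intro closed_Collect_le continuous_trunc_mgf continuous_on_const assms)
  have ne: "{t. trunc_mgf M W (real (n0 + n)) t \<le> r} \<noteq> {}" for n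
  proof -
    obtain m t where "m \<ge> n0 + n" "trunc_mgf M W (real m) t \<le> r" using neg by (metis not_less)
    then show ?thesis using anti[of "n0 + n" m] by blast
  qed
  have dec: "{t. trunc_mgf M W (real (n0 + n)) t \<le> r} \<subseteq> {t. trunc_mgf M W (real (n0 + m)) t \<le> r}"
    if "m \<le> n" for m n using that by (intro anti) simp
  have bd: "bounded {t. trunc_mgf M W (real (n0 + 0)) t \<le> r}" using n0 by simp
  obtain t where t: "\<And>n. t \<in> {t. trunc_mgf M W (real (n0 + n)) t \<le> r}"
    by (rule bounded_closed_nest[of "\<lambda>n. {t. trunc_mgf M W (real (n0 + n)) t \<le> r}", OF cl ne dec bd])
       (assumption, rule that)
  have "trunc_mgf M W (real n) t \<le> r" for n
    using t[of n] anti[of n "n0 + n"] by auto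
  from integrable_exp_of_trunc_mgf_le[OF assms(1) this] gt[of t] show False by simp
qed

end

subsection \<open>Cramer's lower bound\<close>

text \<open>The family lives on \<open>M\<close> and the model variable \<open>W\<close> on
  \<open>N\<close>, so each factor is computed through the common law on the line before
  independence is used.\<close>

lemma (in prob_space) iid_prod_expectation:
  fixes X :: "'i \<Rightarrow> 'a \<Rightarrow> real" and g :: "real \<Rightarrow> real"
  assumes fin: "finite I" and ind: "indep_vars (\<lambda>_. borel) X I"
    and distr: "\<And>i. i \<in> I \<Longrightarrow> distr M borel (X i) = distr N borel W"
    and [measurable]: "W \<in> borel_measurable N" "g \<in> borel_measurable borel"
    and int: "integrable N (\<lambda>\<omega>. g (W \<omega>))"
  shows "integrable M (\<lambda>\<omega>. \<Prod>i\<in>I. g (X i \<omega>))"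
    and "(\<integral>\<omega>. (\<Prod>i\<in>I. g (X i \<omega>)) \<partial>M) = (\<integral>\<omega>. g (W \<omega>) \<partial>N) ^ card I"
proof -
  have [measurable]: "X i \<in> borel_measurable M" if "i \<in> I" for i
    using ind that by (auto simp: indep_vars_def)
  have ind': "indep_vars (\<lambda>_. borel) (\<lambda>i \<omega>. g (X i \<omega>)) I"
    by (rule indep_vars_compose2[OF ind]) simp
  have int': "integrable M (\<lambda>\<omega>. g (X i \<omega>))" if "i \<in> I" for i
  proof -
    have "integrable (distr M borel (X i)) g"
      unfolding distr[OF that] using int by (subst integrable_distr_eq) auto
    then show ?thesis using that by (subst (asm) integrable_distr_eq) auto
  qed
  have eq: "(\<integral>\<omega>. g (X i \<omega>) \<partial>M) = (\<integral>\<omega>. g (W \<omega>) \<partial>N)" if "i \<in> I" for i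
  proof -
    have "(\<integral>\<omega>. g (X i \<omega>) \<partial>M) = integral\<^sup>L (distr M borel (X i)) g"
      using that by (subst integral_distr) auto
    also have "\<dots> = (\<integral>\<omega>. g (W \<omega>) \<partial>N)"
      unfolding distr[OF that] by (subst integral_distr) auto
    finally show ?thesis .
  qed
  show "integrable M (\<lambda>\<omega>. \<Prod>i\<in>I. g (X i \<omega>))"
    by (intro indep_vars_integrable fin ind' int')
  show "(\<integral>\<omega>. (\<Prod>i\<in>I. g (X i \<omega>)) \<partial>M) = (\<integral>\<omega>. g (W \<omega>) \<partial>N) ^ card I"
    by (subst indep_vars_lebesgue_integral[OF fin ind' int']) (simp_all add: eq)
qed

text \<open>A pointwise minorant of the indicator of \<open>S \<le> 0\<close> replaces a change of
  measure. The two subtracted terms penalise \<open>S > 0\<close> and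
  \<open>S < - b * card I\<close>, and the prefactor keeps \<open>exp (t * S)\<close> below one in
  between. Integrating turns every product into a power of \<phi>.\<close>

lemma (in prob_space) prob_iid_sum_nonpos_ge:
  fixes X :: "'i \<Rightarrow> 'a \<Rightarrow> real" and a b s t :: real
  assumes fin: "finite I" and ind: "indep_vars (\<lambda>_. borel) X I"
    and distr: "\<And>i. i \<in> I \<Longrightarrow> distr M borel (X i) = distr N borel W"
    and N: "prob_space N" and [measurable]: "W \<in> borel_measurable N"
    and s: "s > 0" and b: "b \<ge> 0"
  defines "\<phi> \<equiv> trunc_mgf N W a"
  shows "prob {\<omega> \<in> space M. (\<Sum>i\<in>I. X i \<omega>) \<le> 0}
    \<ge> exp (- \<bar>t\<bar> * b) ^ card I * (\<phi> t ^ card I - \<phi> (t + s) ^ card I - (exp (- s * b) * \<phi> (t - s)) ^ card I)"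
proof -
  interpret N: prob_space N by fact
  have [measurable]: "X i \<in> borel_measurable M" if "i \<in> I" for i
    using ind that by (auto simp: indep_vars_def)
  define w where "w u x = indicator {-a..a} x * exp (u * x)" for u x :: real
  have [measurable]: "w u \<in> borel_measurable borel" for u unfolding w_def by measurable
  define P where "P u \<omega> = (\<Prod>i\<in>I. w u (X i \<omega>))" for u \<omega>
  have iW: "integrable N (\<lambda>\<omega>. w u (W \<omega>))" for u
    unfolding w_def by (intro N.trunc_exp_integrable) simp
  have iP: "integrable M (P u)" and eP: "(\<integral>\<omega>. P u \<omega> \<partial>M) = \<phi> u ^ card I" for u
    unfolding P_def \<phi>_def trunc_mgf_def
    using iid_prod_expectation[OF fin ind distr _ _ iW[of u]] by (simp_all add: w_def)
  define K where "K = exp (- \<bar>t\<bar> * b) ^ card I"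
  define R where "R = exp (- s * b) ^ card I"
  have pt: "K * (P t \<omega> - P (t + s) \<omega> - R * P (t - s) \<omega>)
      \<le> indicator {\<omega> \<in> space M. (\<Sum>i\<in>I. X i \<omega>) \<le> 0} \<omega>" if "\<omega> \<in> space M" for \<omega>
  proof -
    define S where "S = (\<Sum>i\<in>I. X i \<omega>)"
    define T where "T = (\<Prod>i\<in>I. indicator {-a..a} (X i \<omega>) :: real)"
    have P: "P u \<omega> = T * exp (u * S)" for u
      unfolding P_def w_def T_def S_def prod.distrib using fin by (simp add: exp_sum sum_distrib_left)
    have T: "0 \<le> T" "T \<le> 1" unfolding T_def by (auto intro!: prod_nonneg prod_le_1)
    have R: "R = exp (- s * b * card I)" unfolding R_def
      by (simp add: exp_of_nat_mult[symmetric] algebra_simps)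
    have K: "K = exp (- \<bar>t\<bar> * b * card I)" unfolding K_def
      by (simp add: exp_of_nat_mult[symmetric] algebra_simps)
    have eq: "K * (P t \<omega> - P (t + s) \<omega> - R * P (t - s) \<omega>)
        = T * (K * exp (t * S)) * (1 - exp (s * S) - exp (- s * (S + b * card I)))"
      unfolding P R by (simp add: algebra_simps flip: exp_add)
    show ?thesis
    \<comment> \<open>Inside this range the bracket is at most one and
      \<open>K * exp (t * S) \<le> 1\<close>. Outside it one of the two exponentials is at least
      one, so the bracket is nonpositive.\<close>
    proof (cases "- (b * card I) \<le> S \<and> S \<le> 0")
      case True
      then have "\<bar>S\<bar> \<le> b * card I" by simp
      then have "\<bar>t\<bar> * \<bar>S\<bar> \<le> \<bar>t\<bar> * (b * card I)" by (intro mult_left_mono) auto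
      moreover have "t * S \<le> \<bar>t\<bar> * \<bar>S\<bar>" by (metis abs_ge_self abs_mult)
      ultimately have "K * exp (t * S) \<le> 1" unfolding K by (simp add: algebra_simps flip: exp_add)
      then have "T * (K * exp (t * S)) \<le> 1 * 1" using T by (intro mult_mono) (auto simp: K)
      moreover have "T * (K * exp (t * S)) * (1 - exp (s * S) - exp (- s * (S + b * card I)))
          \<le> T * (K * exp (t * S)) * 1"
      proof (rule mult_left_mono)
        show "1 - exp (s * S) - exp (- s * (S + b * card I)) \<le> 1"
          using exp_gt_zero[of "s * S"] exp_gt_zero[of "- s * (S + b * card I)"] by linarith
      qed (use T in \<open>simp add: K\<close>)
      ultimately have "T * (K * exp (t * S)) * (1 - exp (s * S) - exp (- s * (S + b * card I))) \<le> 1"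
        by linarith
      then show ?thesis unfolding eq using True that by (simp add: S_def)
    next
      case False
      then have "1 - exp (s * S) - exp (- s * (S + b * card I)) \<le> 0"
      proof (cases "S > 0")
        case True
        then have "exp (s * S) \<ge> 1" using s by simp
        then show ?thesis using exp_gt_zero[of "- s * (S + b * card I)"] by linarith
      next
        case F: False
        then have "S + b * card I \<le> 0" using False by linarith
        then have "- s * (S + b * card I) \<ge> 0" using s by (simp add: mult_nonneg_nonpos)
        then have "exp (- s * (S + b * card I)) \<ge> 1" by (simp only: one_le_exp_iff)
        then show ?thesis using exp_gt_zero[of "s * S"] by linarith
      qed
      then have "T * (K * exp (t * S)) * (1 - exp (s * S) - exp (- s * (S + b * card I))) \<le> 0"
        using T by (intro mult_nonneg_nonpos) (auto simp: K)
      then show ?thesis unfolding eq by (rule order_trans) simp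
    qed
  qed
  have "K * (\<phi> t ^ card I - \<phi> (t + s) ^ card I - R * \<phi> (t - s) ^ card I)
      = (\<integral>\<omega>. K * (P t \<omega> - P (t + s) \<omega> - R * P (t - s) \<omega>) \<partial>M)"
    by (simp add: iP eP)
  also have "\<dots> \<le> (\<integral>\<omega>. indicator {\<omega> \<in> space M. (\<Sum>i\<in>I. X i \<omega>) \<le> 0} \<omega> \<partial>M)"
    by (intro integral_mono pt) (auto simp: iP emeasure_eq_measure intro!: integrable_real_indicator)
  also have "\<dots> = prob {\<omega> \<in> space M. (\<Sum>i\<in>I. X i \<omega>) \<le> 0}" by simp
  finally show ?thesis unfolding K_def R_def by (simp add: power_mult_distrib)
qed

text \<open>After division by \<open>(K * A) ^ n\<close> the claim says that three geometric
  sequences with ratios below one eventually sum to less than one.\<close>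

lemma ex_power_gap:
  fixes A B C K r :: real
  assumes "0 \<le> B" "B < A" "0 \<le> C" "C < A" "0 < K" "0 \<le> r" "r < K * A"
  shows "\<exists>n\<ge>1. r ^ n \<le> K ^ n * (A ^ n - B ^ n - C ^ n)"
proof -
  have lim: "(\<lambda>n. (B / A) ^ n + (C / A) ^ n + (r / (K * A)) ^ n) \<longlonglongrightarrow> 0 + 0 + 0"
    using assms by (intro tendsto_add LIMSEQ_power_zero) auto
  then have "eventually (\<lambda>n. (B / A) ^ n + (C / A) ^ n + (r / (K * A)) ^ n < 1 \<and> n \<ge> 1) sequentially"
    by (intro eventually_conj order_tendstoD(2)[OF lim] eventually_ge_at_top) simp
  then obtain n where n: "(B / A) ^ n + (C / A) ^ n + (r / (K * A)) ^ n < 1" "n \<ge> 1"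
    by (auto simp: eventually_sequentially)
  have "((B / A) ^ n + (C / A) ^ n + (r / (K * A)) ^ n) * (K ^ n * A ^ n) \<le> 1 * (K ^ n * A ^ n)"
    using n assms by (intro mult_right_mono) auto
  moreover have "(B / A) ^ n * (K ^ n * A ^ n) = K ^ n * B ^ n" "(C / A) ^ n * (K ^ n * A ^ n) = K ^ n * C ^ n"
    "(r / (K * A)) ^ n * (K ^ n * A ^ n) = r ^ n"
    using assms by (simp_all add: power_divide power_mult_distrib)
  ultimately have "K ^ n * B ^ n + K ^ n * C ^ n + r ^ n \<le> K ^ n * A ^ n"
    by (simp add: distrib_right)
  then show ?thesis using n(2) by (intro exI[of _ n]) (simp add: algebra_simps)
qed

text \<open>Supplies parameters for which the main term dominates both tail terms exponentially and
  the prefactor still leaves a rate above \<open>r\<close>. The point \<open>t\<close> lies a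
  distance \<open>s\<close> to the left of the leftmost minimiser.\<close>

lemma (in prob_space) ex_near_minimiser:
  assumes W [measurable]: "W \<in> borel_measurable M"
    and pos: "prob {\<omega> \<in> space M. W \<omega> > 0} > 0" "prob {\<omega> \<in> space M. W \<omega> < 0} > 0"
    and r: "r > 0"
    and gt: "\<And>t. integrable M (\<lambda>\<omega>. exp (t * W \<omega>)) \<Longrightarrow> (\<integral>\<omega>. exp (t * W \<omega>) \<partial>M) > r"
  shows "\<exists>a t s b. s > 0 \<and> b \<ge> 0 \<and> trunc_mgf M W a (t + s) < trunc_mgf M W a t
    \<and> exp (- s * b) * trunc_mgf M W a (t - s) < trunc_mgf M W a t
    \<and> r < exp (- \<bar>t\<bar> * b) * trunc_mgf M W a t"
proof -
  obtain n1 where n1: "\<And>n t. n \<ge> n1 \<Longrightarrow> trunc_mgf M W (real n) t > r"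
    using ex_trunc_mgf_gt[OF W pos gt] by blast
  obtain n2 where n2: "\<And>n. n \<ge> n2 \<Longrightarrow> bounded {t. trunc_mgf M W (real n) t \<le> 1}"
    using trunc_mgf_sublevel_bounded[OF W pos] by blast
  \<comment> \<open>Large enough for both thresholds and positive. The level \<open>1\<close> in
    \<open>n2\<close> suffices because \<phi> at \<open>0\<close> is a probability.\<close>
  define a where "a = real (n1 + n2 + 1)"
  define \<phi> where "\<phi> = trunc_mgf M W a"
  have a: "a > 0" by (simp add: a_def)
  have \<phi>_gt: "\<phi> t > r" for t unfolding \<phi>_def a_def by (intro n1) simp
  have "\<phi> 0 \<le> (\<integral>\<omega>. 1 \<partial>M)"
    unfolding \<phi>_def trunc_mgf_def
    by (intro integral_mono trunc_exp_integrable W) (auto split: split_indicator)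
  then have "\<phi> 0 \<le> 1" by (simp add: prob_space)
  then have "{t. \<phi> t \<le> \<phi> 0} \<subseteq> {t. \<phi> t \<le> 1}" by auto
  moreover have "bounded {t. \<phi> t \<le> 1}" unfolding \<phi>_def a_def by (intro n2) simp
  ultimately have "bounded {t. \<phi> t \<le> \<phi> 0}" using bounded_subset by blast
  then obtain t0 where t0: "\<And>u. \<phi> t0 \<le> \<phi> u" "\<And>u. u < t0 \<Longrightarrow> \<phi> t0 < \<phi> u"
    using ex_leftmost_minimiser[of \<phi>] continuous_trunc_mgf[OF W] unfolding \<phi>_def by blast
  \<comment> \<open>Chosen so that \<open>(\<bar>t0\<bar> + 1) * b\<close> is half of
    \<open>ln (\<phi> t0 / r)\<close>: the prefactor then uses up only half of the available gap
    above \<open>r\<close>.\<close>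
  define b where "b = ln (\<phi> t0 / r) / (2 * (\<bar>t0\<bar> + 1))"
  have quot: "\<phi> t0 / r > 1" using \<phi>_gt[of t0] r by simp
  have b: "b > 0" using quot by (auto simp: b_def intro!: divide_pos_pos)
  \<comment> \<open>The three bounds serve in turn to keep \<open>\<bar>t\<bar>\<close> below
    \<open>\<bar>t0\<bar> + 1\<close>, to bring \<open>2 * s * a\<close> into the range of the
    \<open>cosh\<close> estimate, and to make its quadratic error smaller than
    \<open>s * b\<close>.\<close>
  define s where "s = min 1 (min (1 / (2 * a)) (b / (16 * a\<^sup>2)))"
  have s: "s > 0" "s \<le> 1" "s \<le> 1 / (2 * a)" "s \<le> b / (16 * a\<^sup>2)"
    using a b by (auto simp: s_def)
  define t where "t = t0 - s"
  have "\<phi> t0 < exp (- s * b) * 0 + \<phi> t" using s t0(2)[of t] by (simp add: t_def)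
  then have lt: "\<phi> (t + s) < \<phi> t" by (simp add: t_def)
  have sq: "2 * (2 * s * a)\<^sup>2 < s * b"
  proof -
    have "16 * a\<^sup>2 * s \<le> b" using s(4) a by (simp add: field_simps)
    then have "s * (16 * a\<^sup>2 * s) \<le> s * b" using s(1) by (intro mult_left_mono) auto
    moreover have "2 * (2 * s * a)\<^sup>2 < s * (16 * a\<^sup>2 * s)"
      using a s(1) by (simp add: power2_eq_square)
    ultimately show ?thesis by linarith
  qed
  have "cosh (2 * s * a) \<le> 1 + (2 * s * a)\<^sup>2"
    using s(1,3) a by (intro cosh_le_one_plus_square) (simp add: field_simps abs_mult)
  then have "2 * cosh (2 * s * a) - 1 \<le> 1 + 2 * (2 * s * a)\<^sup>2" by simp
  also have "\<dots> < 1 + s * b" using sq by simp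
  also have "\<dots> \<le> exp (s * b)" by (rule exp_ge_add_one_self)
  finally have ch: "2 * cosh (2 * s * a) - 1 < exp (s * b)" .
  \<comment> \<open>Here \<open>t - s = t0 - 2 * s\<close>. Minimality at \<open>t0\<close> bounds
    the value on the other side, at \<open>t0 + 2 * s\<close>, from below, so the
    \<open>cosh\<close> inequality isolates the value at \<open>t - s\<close>.\<close>
  have "\<phi> t0 + \<phi> (t0 - 2 * s) \<le> \<phi> (t0 + 2 * s) + \<phi> (t0 - 2 * s)" using t0(1) by simp
  also have "\<dots> \<le> 2 * cosh (2 * s * a) * \<phi> t0"
    unfolding \<phi>_def by (rule trunc_mgf_add_le[OF W])
  finally have "\<phi> (t - s) \<le> (2 * cosh (2 * s * a) - 1) * \<phi> t0"
    by (simp add: t_def algebra_simps)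
  also have "\<dots> < exp (s * b) * \<phi> t0"
    using ch \<phi>_gt[of t0] r by (intro mult_strict_right_mono) auto
  finally have "exp (- s * b) * \<phi> (t - s) < exp (- s * b) * (exp (s * b) * \<phi> t0)"
    by (intro mult_strict_left_mono) auto
  also have "\<dots> = \<phi> t0" by (simp flip: exp_add mult.assoc)
  also have "\<dots> \<le> \<phi> t" by (rule t0(1))
  finally have lt2: "exp (- s * b) * \<phi> (t - s) < \<phi> t" .
  have "\<bar>t\<bar> * b \<le> (\<bar>t0\<bar> + 1) * b" using s b by (intro mult_right_mono) (auto simp: t_def)
  also have "\<dots> = ln (\<phi> t0 / r) / 2" by (simp add: b_def field_simps)
  also have "\<dots> < ln (\<phi> t0 / r)" using quot by simp
  finally have "exp (\<bar>t\<bar> * b) < exp (ln (\<phi> t0 / r))" by (simp only: exp_less_mono)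
  also have "\<dots> = \<phi> t0 / r" using quot by (simp only: exp_ln)
  also have "\<dots> \<le> \<phi> t / r" using t0(1)[of t] r by (simp add: divide_right_mono)
  finally have "r < exp (- \<bar>t\<bar> * b) * \<phi> t" using r by (simp add: exp_minus field_simps)
  with s(1) b lt lt2 show ?thesis unfolding \<phi>_def by (meson less_imp_le)
qed

text \<open>For an almost surely nonnegative \<open>W\<close> the generating function at
  \<open>- n\<close> tends to the mass of \<open>W\<close> at \<open>0\<close> by dominated
  convergence, and every term exceeds \<open>r\<close>. This is the case where the infimum is
  approached only at minus infinity.\<close>

lemma (in prob_space) prob_nonpos_ge_of_nonneg:
  assumes [measurable]: "W \<in> borel_measurable M"
    and null: "prob {\<omega> \<in> space M. W \<omega> < 0} = 0"
    and gt: "\<And>t. integrable M (\<lambda>\<omega>. exp (t * W \<omega>)) \<Longrightarrow> (\<integral>\<omega>. exp (t * W \<omega>) \<partial>M) > r"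
  shows "r \<le> prob {\<omega> \<in> space M. W \<omega> \<le> 0}"
proof -
  have AE: "AE \<omega> in M. W \<omega> \<ge> 0"
    using null by (intro AE_I[of _ _ "{\<omega> \<in> space M. W \<omega> < 0}"]) (auto simp: emeasure_eq_measure)
  have int: "integrable M (\<lambda>\<omega>. exp (- real n * W \<omega>))" for n
    by (rule integrable_const_bound[where B = 1]) (use AE in auto)
  have "(\<lambda>n. \<integral>\<omega>. exp (- real n * W \<omega>) \<partial>M) \<longlonglongrightarrow> (\<integral>\<omega>. indicator {\<omega> \<in> space M. W \<omega> \<le> 0} \<omega> \<partial>M)"
  proof (rule integral_dominated_convergence[where w = "\<lambda>_. 1"])
    show "AE \<omega> in M. (\<lambda>n. exp (- real n * W \<omega>)) \<longlonglongrightarrow> indicator {\<omega> \<in> space M. W \<omega> \<le> 0} \<omega>"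
      using AE AE_space
    proof eventually_elim
      case (elim \<omega>)
      show ?case
      proof (cases "W \<omega> = 0")
        case False
        then have "W \<omega> > 0" using elim by simp
        have "(\<lambda>n. exp (- W \<omega>) ^ n) \<longlonglongrightarrow> 0"
          using \<open>W \<omega> > 0\<close> by (intro LIMSEQ_power_zero) auto
        then show ?thesis using \<open>W \<omega> > 0\<close> by (simp flip: exp_of_nat_mult)
      qed (use elim in simp)
    qed
    show "AE \<omega> in M. norm (exp (- real n * W \<omega>)) \<le> 1" for n
      using AE by eventually_elim simp
  qed auto
  then have "(\<lambda>n. \<integral>\<omega>. exp (- real n * W \<omega>) \<partial>M) \<longlonglongrightarrow> prob {\<omega> \<in> space M. W \<omega> \<le> 0}"
    by simp
  then show ?thesis
    by (rule LIMSEQ_le_const) (use gt[OF int] in \<open>auto intro: less_imp_le\<close>)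
qed

text \<open>The block length is chosen before the family, so that one \<open>L\<close> serves every
  path of the tree. If a single step already has probability at least \<open>r\<close>, then
  \<open>L = 1\<close> works; otherwise \<open>W\<close> takes both signs with positive probability
  and the near-minimiser applies.\<close>

lemma cramer_lower_bound:
  fixes M :: "'a measure" and N :: "'b measure" and W :: "'b \<Rightarrow> real"
  assumes N: "prob_space N" and W [measurable]: "W \<in> borel_measurable N" and r: "r > 0"
    and gt: "\<And>t. integrable N (\<lambda>\<omega>. exp (t * W \<omega>)) \<Longrightarrow> (\<integral>\<omega>. exp (t * W \<omega>) \<partial>N) > r"
    and M: "prob_space M"
  shows "\<exists>L\<ge>1. \<forall>I (X :: 'i \<Rightarrow> 'a \<Rightarrow> real). finite I \<longrightarrow> card I = L \<longrightarrow>
    prob_space.indep_vars M (\<lambda>_. borel) X I \<longrightarrow>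
    (\<forall>i\<in>I. distr M borel (X i) = distr N borel W) \<longrightarrow>
    r ^ L \<le> measure M {\<omega> \<in> space M. (\<Sum>i\<in>I. X i \<omega>) \<le> 0}"
proof -
  interpret N: prob_space N by fact
  interpret M: prob_space M by fact
  show ?thesis
  proof (cases "r \<le> N.prob {\<omega> \<in> space N. W \<omega> \<le> 0}")
    case True
    have "r \<le> M.prob {\<omega> \<in> space M. (\<Sum>i\<in>I. X i \<omega>) \<le> 0}"
      if I1: "card I = 1" and ind: "M.indep_vars (\<lambda>_. borel) X I"
        and distr: "\<forall>i\<in>I. distr M borel (X i) = distr N borel W"
      for I :: "'i set" and X :: "'i \<Rightarrow> 'a \<Rightarrow> real"
    proof -
      obtain i where I: "I = {i}" using card_1_singletonE[OF I1] by blast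
      have [measurable]: "X i \<in> borel_measurable M" using ind by (auto simp: I M.indep_vars_def)
      have "M.prob {\<omega> \<in> space M. X i \<omega> \<le> 0} = measure (distr M borel (X i)) {..0}"
        by (subst measure_distr) (auto intro!: arg_cong[where f = M.prob])
      also have "\<dots> = N.prob {\<omega> \<in> space N. W \<omega> \<le> 0}"
        using distr unfolding I by (simp, subst measure_distr) (auto intro!: arg_cong[where f = N.prob])
      finally show ?thesis using True by (simp add: I)
    qed
    then show ?thesis by (intro exI[of _ 1]) auto
  next
    case False
    have "N.prob {\<omega> \<in> space N. W \<omega> < 0} \<noteq> 0"
      using N.prob_nonpos_ge_of_nonneg[OF W _ gt] False by blast
    then have neg: "N.prob {\<omega> \<in> space N. W \<omega> < 0} > 0" by (simp add: zero_less_measure_iff)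
    have "r < 1" using gt[of 0] by (simp add: N.prob_space)
    have "N.prob {\<omega> \<in> space N. W \<omega> > 0} = 1 - N.prob {\<omega> \<in> space N. W \<omega> \<le> 0}"
      by (subst N.prob_compl[symmetric]) (auto intro!: arg_cong[where f = N.prob])
    then have pos: "N.prob {\<omega> \<in> space N. W \<omega> > 0} > 0" using False \<open>r < 1\<close> by simp
    obtain a t s b where *: "s > 0" "b \<ge> 0" "trunc_mgf N W a (t + s) < trunc_mgf N W a t"
        "exp (- s * b) * trunc_mgf N W a (t - s) < trunc_mgf N W a t"
        "r < exp (- \<bar>t\<bar> * b) * trunc_mgf N W a t"
      using N.ex_near_minimiser[OF W pos neg r gt] by blast
    obtain L where L: "L \<ge> 1" "r ^ L \<le> exp (- \<bar>t\<bar> * b) ^ L * (trunc_mgf N W a t ^ L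
        - trunc_mgf N W a (t + s) ^ L - (exp (- s * b) * trunc_mgf N W a (t - s)) ^ L)"
      using ex_power_gap[OF N.trunc_mgf_nonneg *(3) _ *(4) _ less_imp_le[OF r] *(5)] N.trunc_mgf_nonneg
      by (metis exp_ge_zero exp_gt_zero mult_nonneg_nonneg)
    show ?thesis
      using L M.prob_iid_sum_nonpos_ge[OF _ _ _ N W *(1,2)] by (intro exI[of _ L]) (blast intro: order_trans)
  qed
qed

subsection \<open>Branching recursion\<close>

text \<open>The root is left out because its displacement is identically zero and does not belong to
  the independent family.\<close>

definition nonempty_prefixes :: "'c list \<Rightarrow> 'c list set" where
  "nonempty_prefixes u = {v. prefix v u \<and> v \<noteq> []}"

lemma nonempty_prefixes_eq_image: "nonempty_prefixes u = (\<lambda>n. take n u) ` {1..length u}"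
proof (intro equalityI subsetI)
  fix v assume "v \<in> nonempty_prefixes u"
  then have "v = take (length v) u" "length v \<in> {1..length u}"
    by (auto simp: nonempty_prefixes_def prefix_def Suc_le_eq)
  then show "v \<in> (\<lambda>n. take n u) ` {1..length u}" by blast
qed (auto simp: nonempty_prefixes_def take_is_prefix)

lemma finite_nonempty_prefixes [simp]: "finite (nonempty_prefixes u)"
  by (simp add: nonempty_prefixes_eq_image)

lemma card_nonempty_prefixes: "card (nonempty_prefixes u) = length u"
proof -
  have "inj_on (\<lambda>n. take n u) {1..length u}"
    by (rule inj_on_inverseI[of _ length]) simp
  then show ?thesis by (simp add: nonempty_prefixes_eq_image card_image)
qed

lemma nonempty_prefixes_Nil [simp]: "nonempty_prefixes [] = {}"
  by (simp add: nonempty_prefixes_eq_image)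

lemma nonempty_prefixes_append:
  "nonempty_prefixes (w @ v) = nonempty_prefixes w \<union> (@) w ` nonempty_prefixes v"
  by (auto simp: nonempty_prefixes_def prefix_append)

lemma sum_nonempty_prefixes_append:
  fixes f :: "'c list \<Rightarrow> real"
  shows "(\<Sum>u\<in>nonempty_prefixes (w @ v). f u)
    = (\<Sum>u\<in>nonempty_prefixes w. f u) + (\<Sum>u\<in>nonempty_prefixes v. f (w @ u))"
proof -
  have "(\<Sum>u\<in>nonempty_prefixes (w @ v). f u)
      = (\<Sum>u\<in>nonempty_prefixes w. f u) + (\<Sum>u\<in>(@) w ` nonempty_prefixes v. f u)"
    unfolding nonempty_prefixes_append
    by (intro sum.union_disjoint finite_imageI finite_nonempty_prefixes)
       (auto simp: nonempty_prefixes_def dest: prefix_length_le)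
  then show ?thesis by (simp add: sum.reindex inj_on_def)
qed

definition level :: "nat \<Rightarrow> nat \<Rightarrow> nat list set" where
  "level k m = {u \<in> words k. length u = m}"

lemma level_eq: "level k m = {u. set u \<subseteq> {1..k} \<and> length u = m}"
  by (simp add: level_def words_def)

lemma finite_level [simp]: "finite (level k m)"
  unfolding level_eq by (rule finite_lists_length_eq) simp

lemma card_level: "card (level k m) = k ^ m"
  unfolding level_eq by (subst card_lists_length_eq) auto

lemma level_0 [simp]: "level k 0 = {[]}"
  by (auto simp: level_eq)

lemma level_append: "w \<in> level k l \<Longrightarrow> v \<in> level k m \<Longrightarrow> w @ v \<in> level k (l + m)"
  by (auto simp: level_eq)

lemma words_append_iff [simp]: "w @ v \<in> words k \<longleftrightarrow> w \<in> words k \<and> v \<in> words k"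
  by (auto simp: words_def)

lemma nonempty_prefixes_subset_words:
  "u \<in> words k \<Longrightarrow> nonempty_prefixes u \<subseteq> words k - {[]}"
  by (auto simp: words_def nonempty_prefixes_def dest: set_mono_prefix)

section \<open>Independence over disjoint index sets and a second-order union bound\<close>

context prob_space
begin

text \<open>A finite subfamily indexed by \<open>J\<close> corresponds to the image of
  \<open>J\<close>, and injectivity preserves the product. It is used to shift a subtree back to the
  root.\<close>

lemma indep_vars_reindex_inj:
  assumes inj: "inj_on h I" and ind: "indep_vars M' X (h ` I)"
  shows "indep_vars (\<lambda>i. M' (h i)) (\<lambda>i. X (h i)) I"
proof -
  have "indep_sets (\<lambda>i. F (h i)) I" if ind: "indep_sets F (h ` I)" for F :: "_ \<Rightarrow> 'a set set"
    unfolding indep_sets_def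
  proof (intro conjI allI impI ballI)
    show "F (h i) \<subseteq> events" if "i \<in> I" for i using ind that by (auto simp: indep_sets_def)
  next
    fix J A assume J: "J \<subseteq> I" "J \<noteq> {}" "finite J" and A: "A \<in> (\<Pi> i\<in>J. F (h i))"
    define g where "g = inv_into I h"
    have g: "g (h i) = i" if "i \<in> J" for i
      using that J(1) inj by (auto simp: g_def intro: inv_into_f_f)
    have "(\<lambda>j. A (g j)) \<in> Pi (h ` J) F" using A g by auto
    then have "prob (\<Inter>j\<in>h ` J. A (g j)) = (\<Prod>j\<in>h ` J. prob (A (g j)))"
      using J by (intro indep_setsD[OF ind]) auto
    then show "prob (\<Inter>j\<in>J. A j) = (\<Prod>j\<in>J. prob (A j))"
      using g inj_on_subset[OF inj J(1)] by (simp add: prod.reindex)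
  qed
  from this[of "\<lambda>i. {X i -` A \<inter> space M |A. A \<in> sets (M' i)}"] show ?thesis
    using ind by (simp add: indep_vars_def2)
qed

text \<open>Induction by inclusion-exclusion for one additional event. The double sum runs over
  ordered pairs, so each intersection is subtracted twice; this form is weaker than the classical
  one but costs only a constant.\<close>

lemma bonferroni:
  assumes "finite I" "\<And>i. i \<in> I \<Longrightarrow> E i \<in> events"
  shows "prob (\<Union>i\<in>I. E i) \<ge> (\<Sum>i\<in>I. prob (E i)) - (\<Sum>i\<in>I. \<Sum>j\<in>I - {i}. prob (E i \<inter> E j))"
  using assms
proof (induction I rule: finite_induct)
  case (insert x F)
  have [measurable]: "E x \<in> events" "(\<Union>i\<in>F. E i) \<in> events" using insert by auto
  have "prob (E x \<inter> (\<Union>i\<in>F. E i)) \<le> (\<Sum>i\<in>F. prob (E x \<inter> E i))"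
    unfolding Int_UN_distrib using insert by (intro finite_measure_subadditive_finite) auto
  moreover have "prob (\<Union>i\<in>insert x F. E i)
      = prob (E x) + prob (\<Union>i\<in>F. E i) - prob (E x \<inter> (\<Union>i\<in>F. E i))"
    by (simp add: measure_Un3 fmeasurable_eq_sets)
  moreover have "(\<Sum>i\<in>F. \<Sum>j\<in>F - {i}. prob (E i \<inter> E j)) \<le> (\<Sum>i\<in>F. \<Sum>j\<in>insert x F - {i}. prob (E i \<inter> E j))"
    by (intro sum_mono sum_mono2) (use insert in auto)
  moreover have "insert x F - {x} = F" using insert by auto
  ultimately show ?case using insert by simp
qed simp

text \<open>Membership in the sigma-algebra generated by the variables indexed by \<open>S\<close>,
  written as a preimage under the restricted family to match the independence of such
  restrictions.\<close>

definition determined_by :: "('i \<Rightarrow> 'a \<Rightarrow> real) \<Rightarrow> 'i set \<Rightarrow> 'a set \<Rightarrow> bool" where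
  "determined_by X S A \<longleftrightarrow>
    (\<exists>E\<in>sets (PiM S (\<lambda>_. borel)). A = (\<lambda>\<omega>. \<lambda>i\<in>S. X i \<omega>) -` E \<inter> space M)"

lemma determined_by_in_events:
  assumes "indep_vars (\<lambda>_. borel) X I" "S \<subseteq> I" "determined_by X S A"
  shows "A \<in> events"
proof -
  have "(\<lambda>\<omega>. \<lambda>i\<in>S. X i \<omega>) \<in> M \<rightarrow>\<^sub>M PiM S (\<lambda>_. borel)"
    using assms(1,2) by (intro measurable_restrict) (auto simp: indep_vars_def)
  then show ?thesis using assms(3) by (auto simp: determined_by_def)
qed

lemma prob_Int_determined_by:
  assumes "indep_vars (\<lambda>_. borel) X I" "S \<subseteq> I" "T \<subseteq> I" "S \<inter> T = {}"
    and "determined_by X S A" "determined_by X T B"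
  shows "prob (A \<inter> B) = prob A * prob B"
proof -
  obtain E F where E: "E \<in> sets (PiM S (\<lambda>_. borel))" "A = (\<lambda>\<omega>. \<lambda>i\<in>S. X i \<omega>) -` E \<inter> space M"
    and F: "F \<in> sets (PiM T (\<lambda>_. borel))" "B = (\<lambda>\<omega>. \<lambda>i\<in>T. X i \<omega>) -` F \<inter> space M"
    using assms(5,6) by (auto simp: determined_by_def)
  have "A \<inter> B = (\<lambda>\<omega>. (\<lambda>i\<in>S. X i \<omega>, \<lambda>i\<in>T. X i \<omega>)) -` (E \<times> F) \<inter> space M"
    unfolding E(2) F(2) by auto
  then show ?thesis
    using indep_varD[OF indep_var_restrict[OF assms(1,4,2,3)] E(1) F(1)] E(2) F(2) by simp
qed

end

section \<open>Events of the branching random walk and the branching property\<close>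

locale branching_random_walk = prob_space M
  for M :: "'a measure" +
  fixes k :: nat and N :: "'b measure" and Y :: "'b \<Rightarrow> real" and X :: "nat list \<Rightarrow> 'a \<Rightarrow> real"
  assumes displacements: "brw_displacements k N Y M X" and k_pos: "k \<ge> 1"
begin

lemma indep: "indep_vars (\<lambda>_. borel) X (words k - {[]})"
  using displacements by (simp add: brw_displacements_def)

lemma distr_displacement: "u \<in> words k \<Longrightarrow> u \<noteq> [] \<Longrightarrow> distr M borel (X u) = distr N borel Y"
  using displacements by (simp add: brw_displacements_def)

lemma measurable_displacement: "u \<in> words k \<Longrightarrow> u \<noteq> [] \<Longrightarrow> X u \<in> borel_measurable M"
  using indep by (simp add: indep_vars_def)

lemma level_nonempty: "level k m \<noteq> {}"
  using card_level[of k m] k_pos by force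

definition path_le :: "nat list \<Rightarrow> real \<Rightarrow> 'a set" where
  "path_le w c = {\<omega> \<in> space M. (\<Sum>v\<in>nonempty_prefixes w. X v \<omega>) \<le> c}"

text \<open>Positions are measured relative to \<open>w\<close>: displacements at \<open>w\<close>
  and above are not counted. With \<open>w = []\<close> this is the event for the minimum at level
  \<open>m\<close>.\<close>

definition subtree_le :: "nat list \<Rightarrow> nat \<Rightarrow> real \<Rightarrow> 'a set" where
  "subtree_le w m c = {\<omega> \<in> space M. \<exists>u\<in>level k m. (\<Sum>v\<in>nonempty_prefixes u. X (w @ v) \<omega>) \<le> c}"

lemma brw_position_eq:
  assumes "\<omega> \<in> space M"
  shows "brw_position X u \<omega> = (\<Sum>v\<in>nonempty_prefixes u. X v \<omega>)"
proof -
  have "{v. prefix v u} = insert [] (nonempty_prefixes u)" "[] \<notin> nonempty_prefixes u"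
    by (auto simp: nonempty_prefixes_def)
  then show ?thesis
    using assms displacements by (simp add: brw_position_def brw_displacements_def)
qed

lemma brw_min_le_eq:
  "{\<omega> \<in> space M. brw_min k X m \<omega> \<le> c} = subtree_le [] m c"
proof -
  have "brw_min k X m \<omega> \<le> c \<longleftrightarrow> (\<exists>u\<in>level k m. brw_position X u \<omega> \<le> c)" for \<omega>
    unfolding brw_min_def level_def[symmetric] using level_nonempty by (subst Min_le_iff) auto
  then show ?thesis by (auto simp: subtree_le_def brw_position_eq)
qed

lemma subtree_le_Nil_eq_UN: "subtree_le [] m c = (\<Union>u\<in>level k m. path_le u c)"
  by (auto simp: subtree_le_def path_le_def)

lemma path_le_determined: "determined_by X (nonempty_prefixes w) (path_le w c)"
proof -
  define E where "E = {x \<in> space (PiM (nonempty_prefixes w) (\<lambda>_. borel)).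
    (\<Sum>v\<in>nonempty_prefixes w. x v) \<le> (c::real)}"
  have "E \<in> sets (PiM (nonempty_prefixes w) (\<lambda>_. borel))" unfolding E_def by measurable
  moreover have "path_le w c = (\<lambda>\<omega>. \<lambda>i\<in>nonempty_prefixes w. X i \<omega>) -` E \<inter> space M"
    by (auto simp: path_le_def E_def space_PiM)
  ultimately show ?thesis by (auto simp: determined_by_def)
qed

lemma path_le_in_events [measurable]: "w \<in> words k \<Longrightarrow> path_le w c \<in> events"
  using determined_by_in_events[OF indep nonempty_prefixes_subset_words path_le_determined] .

text \<open>The vertices strictly below \<open>w\<close>, down to \<open>m\<close> generations.
  These sets are disjoint for distinct \<open>w\<close> of equal length, and disjoint from the path
  leading to \<open>w\<close>, which is the source of all independence used below.\<close>

definition descendants :: "nat list \<Rightarrow> nat \<Rightarrow> nat list set" where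
  "descendants w m = (@) w ` (\<Union>u\<in>level k m. nonempty_prefixes u)"

lemma descendants_subset_words: "w \<in> words k \<Longrightarrow> descendants w m \<subseteq> words k - {[]}"
  using nonempty_prefixes_subset_words[of _ k]
  by (fastforce simp: descendants_def level_def)

lemma subtree_event_in_sets:
  assumes "\<And>u. u \<in> level k m \<Longrightarrow> h ` nonempty_prefixes u \<subseteq> D"
  shows "{x \<in> space (PiM D (\<lambda>_. borel)). \<exists>u\<in>level k m. (\<Sum>v\<in>nonempty_prefixes u. x (h v)) \<le> (c::real)}
    \<in> sets (PiM D (\<lambda>_. borel))"
proof -
  have "{x \<in> space (PiM D (\<lambda>_. borel)). (\<Sum>v\<in>nonempty_prefixes u. x (h v)) \<le> c} \<in> sets (PiM D (\<lambda>_. borel))"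
    if "u \<in> level k m" for u
  proof -
    have "(\<lambda>x. \<Sum>v\<in>nonempty_prefixes u. x (h v)) \<in> borel_measurable (PiM D (\<lambda>_. borel :: real measure))"
      using assms[OF that] by (intro borel_measurable_sum measurable_component_singleton) auto
    then show ?thesis by measurable
  qed
  then have "(\<Union>u\<in>level k m. {x \<in> space (PiM D (\<lambda>_. borel)). (\<Sum>v\<in>nonempty_prefixes u. x (h v)) \<le> c})
      \<in> sets (PiM D (\<lambda>_. borel))"
    by (intro sets.finite_UN) auto
  also have "(\<Union>u\<in>level k m. {x \<in> space (PiM D (\<lambda>_. borel)). (\<Sum>v\<in>nonempty_prefixes u. x (h v)) \<le> c})
    = {x \<in> space (PiM D (\<lambda>_. borel)). \<exists>u\<in>level k m. (\<Sum>v\<in>nonempty_prefixes u. x (h v)) \<le> c}"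
    by auto
  finally show ?thesis .
qed

lemma subtree_le_determined: "determined_by X (descendants w m) (subtree_le w m c)"
proof -
  define E where "E = {x \<in> space (PiM (descendants w m) (\<lambda>_. borel)).
    \<exists>u\<in>level k m. (\<Sum>v\<in>nonempty_prefixes u. x (w @ v)) \<le> (c::real)}"
  have "E \<in> sets (PiM (descendants w m) (\<lambda>_. borel))"
    unfolding E_def by (intro subtree_event_in_sets) (auto simp: descendants_def)
  moreover have "(\<Sum>v\<in>nonempty_prefixes u. (\<lambda>i\<in>descendants w m. X i \<omega>) (w @ v))
      = (\<Sum>v\<in>nonempty_prefixes u. X (w @ v) \<omega>)" if "u \<in> level k m" for u \<omega>
    using that by (intro sum.cong) (auto simp: descendants_def)
  then have "subtree_le w m c = (\<lambda>\<omega>. \<lambda>i\<in>descendants w m. X i \<omega>) -` E \<inter> space M"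
    by (auto simp: subtree_le_def E_def space_PiM)
  ultimately show ?thesis by (auto simp: determined_by_def)
qed

lemma subtree_le_in_events [measurable]: "w \<in> words k \<Longrightarrow> subtree_le w m c \<in> events"
  using determined_by_in_events[OF indep descendants_subset_words subtree_le_determined] .

text \<open>The event is the same measurable set \<open>E\<close> evaluated at the displacements
  shifted by \<open>w\<close>, and their joint law is a product measure in which \<open>w\<close>
  does not appear.\<close>

lemma prob_subtree_le:
  assumes w: "w \<in> words k"
  shows "prob (subtree_le w m c) = prob (subtree_le [] m c)"
\<comment> \<open>At depth zero the index set \<open>D\<close> would be empty, while the product
  description of the joint law is applied to a nonempty one.\<close>
proof (cases "m = 0")
  case True
  then show ?thesis by (simp add: subtree_le_def)
next
  case False
  define D where "D = (\<Union>u\<in>level k m. nonempty_prefixes u)"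
  have D_words: "D \<subseteq> words k - {[]}"
    using nonempty_prefixes_subset_words[of _ k] by (fastforce simp: D_def level_def)
  obtain u where u: "u \<in> level k m" using level_nonempty by blast
  with False have "u \<in> nonempty_prefixes u" by (auto simp: nonempty_prefixes_def level_def)
  with u have "D \<noteq> {}" by (auto simp: D_def)
  define E where "E = {x \<in> space (PiM D (\<lambda>_. borel)). \<exists>u\<in>level k m. (\<Sum>v\<in>nonempty_prefixes u. x v) \<le> c}"
  have E: "E \<in> sets (PiM D (\<lambda>_. borel))"
    unfolding E_def using subtree_event_in_sets[of m "\<lambda>v. v" D c] by (auto simp: D_def)
  have *: "prob (subtree_le w m c) = measure (PiM D (\<lambda>_. distr N borel Y)) E" if w: "w \<in> words k" for w
  proof -
    have inj: "inj_on ((@) w) D" by (simp add: inj_on_def)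
    have "(@) w ` D \<subseteq> words k - {[]}" using D_words w by auto
    then have ind: "indep_vars (\<lambda>_. borel) (\<lambda>v. X (w @ v)) D"
      by (intro indep_vars_reindex_inj[OF inj] indep_vars_subset[OF indep])
    have meas: "X (w @ v) \<in> borel_measurable M" if "v \<in> D" for v
      using that D_words w by (intro measurable_displacement) auto
    have "distr M (PiM D (\<lambda>_. borel)) (\<lambda>\<omega>. \<lambda>v\<in>D. X (w @ v) \<omega>) = PiM D (\<lambda>v. distr M borel (X (w @ v)))"
      using indep_vars_iff_distr_eq_PiM'[OF \<open>D \<noteq> {}\<close> meas] ind by simp
    also have "\<dots> = PiM D (\<lambda>_. distr N borel Y)"
      using D_words w by (intro PiM_cong distr_displacement) auto
    finally have eq: "distr M (PiM D (\<lambda>_. borel)) (\<lambda>\<omega>. \<lambda>v\<in>D. X (w @ v) \<omega>) = PiM D (\<lambda>_. distr N borel Y)" .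
    have "(\<Sum>v\<in>nonempty_prefixes u. (\<lambda>v\<in>D. X (w @ v) \<omega>) v) = (\<Sum>v\<in>nonempty_prefixes u. X (w @ v) \<omega>)"
      if "u \<in> level k m" for u \<omega> using that by (intro sum.cong) (auto simp: D_def)
    then have "subtree_le w m c = (\<lambda>\<omega>. \<lambda>v\<in>D. X (w @ v) \<omega>) -` E \<inter> space M"
      by (auto simp: subtree_le_def E_def space_PiM)
    then have "prob (subtree_le w m c) = measure (distr M (PiM D (\<lambda>_. borel)) (\<lambda>\<omega>. \<lambda>v\<in>D. X (w @ v) \<omega>)) E"
      using meas by (subst measure_distr[OF measurable_restrict E]) auto
    then show ?thesis by (simp only: eq)
  qed
  show ?thesis using *[OF w] *[of "[]"] by (simp add: words_def)
qed

lemma path_le_Int_subtree_le_subset: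
  assumes "w \<in> level k l"
  shows "path_le w c \<inter> subtree_le w m d \<subseteq> subtree_le [] (l + m) (c + d)"
proof
  fix \<omega> assume *: "\<omega> \<in> path_le w c \<inter> subtree_le w m d"
  then obtain u where u: "u \<in> level k m" "(\<Sum>v\<in>nonempty_prefixes u. X (w @ v) \<omega>) \<le> d"
    by (auto simp: subtree_le_def)
  have "(\<Sum>v\<in>nonempty_prefixes (w @ u). X v \<omega>) \<le> c + d"
    using * u(2) by (simp add: sum_nonempty_prefixes_append path_le_def)
  then show "\<omega> \<in> subtree_le [] (l + m) (c + d)"
    using * level_append[OF assms u(1)] by (auto simp: subtree_le_def)
qed

lemma prob_path_le_Int_subtree_le:
  assumes "w \<in> words k"
  shows "prob (path_le w c \<inter> subtree_le w m d) = prob (path_le w c) * prob (subtree_le [] m d)"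
proof -
  have "nonempty_prefixes w \<inter> descendants w m = {}"
    by (auto simp: nonempty_prefixes_def descendants_def dest: prefix_length_le)
  then show ?thesis
    using prob_Int_determined_by[OF indep nonempty_prefixes_subset_words[OF assms]
        descendants_subset_words[OF assms] _ path_le_determined subtree_le_determined] 
      prob_subtree_le[OF assms] by simp
qed

lemma prob_subtree_le_Int_subtree_le:
  assumes "w \<in> level k l" "w' \<in> level k l" "w \<noteq> w'"
  shows "prob (subtree_le w m d \<inter> subtree_le w' m d) = prob (subtree_le [] m d) ^ 2"
proof -
  have ww: "w \<in> words k" "w' \<in> words k" using assms by (auto simp: level_def)
  have "descendants w m \<inter> descendants w' m = {}"
    using assms by (auto simp: descendants_def level_def)
  then show ?thesis
    using prob_Int_determined_by[OF indep descendants_subset_words[OF ww(1)]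
        descendants_subset_words[OF ww(2)] _ subtree_le_determined subtree_le_determined]
      prob_subtree_le[OF ww(1)] prob_subtree_le[OF ww(2)] by (simp add: power2_eq_square)
qed

lemma prob_subtree_le_add_ge:
  assumes w: "w \<in> level k l"
  shows "prob (subtree_le [] (l + m) (c + d)) \<ge> prob (path_le w c) * prob (subtree_le [] m d)"
proof -
  have "w \<in> words k" using w by (simp add: level_def)
  then have "prob (path_le w c) * prob (subtree_le [] m d) = prob (path_le w c \<inter> subtree_le w m d)"
    by (simp add: prob_path_le_Int_subtree_le)
  also have "\<dots> \<le> prob (subtree_le [] (l + m) (c + d))"
    by (intro finite_measure_mono path_le_Int_subtree_le_subset w subtree_le_in_events) (simp add: words_def)
  finally show ?thesis .
qed

text \<open>Bonferroni over the vertices \<open>w\<close> of level \<open>l\<close>, each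
  contributing a good path to \<open>w\<close> followed by a good subtree below it. The first-order
  terms factorise, and there are at most \<open>(k ^ l)\<^sup>2\<close> ordered pairs.\<close>

lemma prob_subtree_le_add_ge_quadratic:
  assumes q: "\<And>w. w \<in> level k l \<Longrightarrow> q \<le> prob (path_le w c)"
  shows "prob (subtree_le [] (l + m) (c + d))
    \<ge> real k ^ l * q * prob (subtree_le [] m d) - (real k ^ l * prob (subtree_le [] m d))\<^sup>2"
proof -
  define p where "p = prob (subtree_le [] m d)"
  define E where "E w = path_le w c \<inter> subtree_le w m d" for w
  have lw: "w \<in> words k" if "w \<in> level k l" for w using that by (simp add: level_def)
  have E: "E w \<in> events" if "w \<in> level k l" for w using lw[OF that] by (auto simp: E_def)
  have "real k ^ l * q * p = (\<Sum>w\<in>level k l. q * p)" by (simp add: card_level)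
  also have "\<dots> \<le> (\<Sum>w\<in>level k l. prob (E w))"
    using q by (intro sum_mono) (simp add: E_def prob_path_le_Int_subtree_le lw p_def mult_right_mono)
  finally have 1: "real k ^ l * q * p \<le> (\<Sum>w\<in>level k l. prob (E w))" .
  have "(\<Sum>w\<in>level k l. \<Sum>w'\<in>level k l - {w}. prob (E w \<inter> E w')) \<le> (\<Sum>w\<in>level k l. \<Sum>w'\<in>level k l - {w}. p\<^sup>2)"
  proof (intro sum_mono)
    fix w w' assume *: "w \<in> level k l" "w' \<in> level k l - {w}"
    \<comment> \<open>The path events are dropped because two paths may share vertices; the subtrees
      alone are independent.\<close>
    have "prob (E w \<inter> E w') \<le> prob (subtree_le w m d \<inter> subtree_le w' m d)"
      using * lw by (intro finite_measure_mono) (auto simp: E_def)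
    also have "\<dots> = p\<^sup>2" unfolding p_def using * by (intro prob_subtree_le_Int_subtree_le) auto
    finally show "prob (E w \<inter> E w') \<le> p\<^sup>2" .
  qed
  also have "\<dots> \<le> (\<Sum>w\<in>level k l. \<Sum>w'\<in>level k l. p\<^sup>2)"
    by (intro sum_mono sum_mono2) auto
  also have "\<dots> = (real k ^ l * p)\<^sup>2" by (simp add: card_level power2_eq_square)
  finally have 2: "(\<Sum>w\<in>level k l. \<Sum>w'\<in>level k l - {w}. prob (E w \<inter> E w')) \<le> (real k ^ l * p)\<^sup>2" .
  have "(\<Sum>w\<in>level k l. prob (E w)) - (\<Sum>w\<in>level k l. \<Sum>w'\<in>level k l - {w}. prob (E w \<inter> E w'))
      \<le> prob (\<Union>w\<in>level k l. E w)"
    by (rule bonferroni) (auto simp: E)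
  also have "\<dots> \<le> prob (subtree_le [] (l + m) (c + d))"
    using path_le_Int_subtree_le_subset unfolding E_def
    by (intro finite_measure_mono) (fastforce simp: words_def)+
  finally show ?thesis using 1 2 unfolding p_def by linarith
qed

end

text \<open>While \<open>p m\<close> is below \<open>(\<mu> - t ^ L) / B\<close> the quadratic
  term costs less than the gap between \<open>\<mu>\<close> and \<open>t ^ L\<close>, and otherwise \<open>p (L + m)\<close> is bounded
  below by a constant.\<close>

lemma geometric_lower_bound:
  fixes p :: "nat \<Rightarrow> real" and q \<mu> B t :: real
  assumes L: "L \<ge> 1" and pos: "\<And>m. p m > 0" and t: "0 < t" "t \<le> 1" "t ^ L < \<mu>" and B: "B > 0" and q: "q > 0"
    and rec1: "\<And>m. p (L + m) \<ge> q * p m"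
    and rec2: "\<And>m. p (L + m) \<ge> \<mu> * p m - B * (p m)\<^sup>2"
  shows "\<exists>c>0. \<forall>m. p m \<ge> c * t ^ m"
proof -
  define a where "a = (\<mu> - t ^ L) / B"
  \<comment> \<open>The first entry starts the induction on a full block of \<open>L\<close>
    indices; the second covers the case where \<open>p n\<close> is at least
    \<open>a\<close>.\<close>
  define c where "c = min (Min (p ` {..<L})) (q * a)"
  have a: "a > 0" using t B by (simp add: a_def)
  have "Min (p ` {..<L}) > 0" using L pos by (subst Min_gr_iff) (auto simp: lessThan_empty_iff bot_nat_def)
  then have c: "c > 0" using a q by (simp add: c_def)
  have le_one: "c * t ^ m \<le> c" for m
    using c t by (simp add: mult_left_le power_le_one)
  have "p m \<ge> c * t ^ m" for m
  proof (induction m rule: less_induct)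
    case (less m)
    show ?case
    proof (cases "m < L")
      case True
      have "c * t ^ m \<le> c" by (rule le_one)
      also have "\<dots> \<le> Min (p ` {..<L})" by (simp add: c_def)
      also have "\<dots> \<le> p m" using True by (intro Min_le) auto
      finally show ?thesis .
    next
      case False
      then obtain n where n: "m = L + n" using le_Suc_ex by (metis not_less)
      show ?thesis
      proof (cases "p n \<ge> a")
        case True
        have "c * t ^ m \<le> c" by (rule le_one)
        also have "\<dots> \<le> q * a" by (simp add: c_def)
        also have "\<dots> \<le> q * p n" using True q by (intro mult_left_mono) auto
        also have "\<dots> \<le> p m" unfolding n by (rule rec1)
        finally show ?thesis .
      next
        case False
        then have "B * p n \<le> \<mu> - t ^ L" using B by (simp add: a_def field_simps)
        then have "B * p n * p n \<le> (\<mu> - t ^ L) * p n" using pos[of n] by (intro mult_right_mono) auto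
        then have "t ^ L * p n \<le> p m" using rec2[of n] by (simp add: n power2_eq_square algebra_simps)
        moreover have "t ^ L * (c * t ^ n) \<le> t ^ L * p n"
          using less.IH[of n] n L t(1) by (intro mult_left_mono) auto
        ultimately show ?thesis by (simp add: n power_add algebra_simps)
      qed
    qed
  qed
  with c show ?thesis by blast
qed

subsection \<open>Rate function and speed\<close>

lemma abs_le_exp_sum:
  fixes a b y :: real
  assumes "a < 0" "b > 0"
  shows "\<bar>y\<bar> \<le> exp (b * y) / b + exp (a * y) / (- a)"
proof (cases "y \<ge> 0")
  case True
  have "b * y \<le> exp (b * y)" using exp_ge_add_one_self[of "b * y"] by linarith
  then have "y \<le> exp (b * y) / b" using assms by (simp add: field_simps)
  moreover have "exp (a * y) / (- a) \<ge> 0" using assms by (intro divide_nonneg_pos) auto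
  ultimately show ?thesis using True by linarith
next
  case False
  have "a * y \<le> exp (a * y)" using exp_ge_add_one_self[of "a * y"] by linarith
  then have "- y \<le> exp (a * y) / (- a)" using assms by (simp add: field_simps)
  moreover have "exp (b * y) / b \<ge> 0" using assms by (intro divide_nonneg_pos) auto
  ultimately show ?thesis using False by linarith
qed

context prob_space
begin

lemma mgf_pos:
  fixes Y :: "'a \<Rightarrow> real" and t :: real
  assumes "integrable M (\<lambda>\<omega>. exp (t * Y \<omega>))"
  shows "(\<integral>\<omega>. exp (t * Y \<omega>) \<partial>M) > 0"
proof -
  have "(\<integral>\<omega>. exp (t * Y \<omega>) \<partial>M) \<noteq> 0"
    using assms by (subst integral_nonneg_eq_0_iff_AE) auto
  moreover have "(\<integral>\<omega>. exp (t * Y \<omega>) \<partial>M) \<ge> 0" by (intro integral_nonneg_AE) auto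
  ultimately show ?thesis by linarith
qed

text \<open>Jensen's inequality, obtained by integrating the tangent line of the exponential at the
  mean.\<close>

lemma exp_expectation_le_mgf:
  fixes Y :: "'a \<Rightarrow> real" and t :: real
  assumes "integrable M Y" and int: "integrable M (\<lambda>\<omega>. exp (t * Y \<omega>))"
  shows "exp (t * expectation Y) \<le> (\<integral>\<omega>. exp (t * Y \<omega>) \<partial>M)"
proof -
  define e where "e = expectation Y"
  have "exp (t * e) * (1 + t * (Y \<omega> - e)) \<le> exp (t * Y \<omega>)" for \<omega>
  proof -
    have "exp (t * e) * (1 + t * (Y \<omega> - e)) \<le> exp (t * e) * exp (t * (Y \<omega> - e))"
      by (intro mult_left_mono exp_ge_add_one_self) simp
    then show ?thesis by (simp add: algebra_simps flip: exp_add)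
  qed
  then have "(\<integral>\<omega>. exp (t * e) * (1 + t * (Y \<omega> - e)) \<partial>M) \<le> (\<integral>\<omega>. exp (t * Y \<omega>) \<partial>M)"
    using assms by (intro integral_mono) auto
  then show ?thesis using assms by (simp add: prob_space e_def)
qed

lemma integrable_of_two_sided_mgf:
  fixes Y :: "'a \<Rightarrow> real" and a b :: real
  assumes [measurable]: "Y \<in> borel_measurable M"
    and "a < 0" "integrable M (\<lambda>\<omega>. exp (a * Y \<omega>))"
    and "b > 0" "integrable M (\<lambda>\<omega>. exp (b * Y \<omega>))"
  shows "integrable M Y"
proof (rule Bochner_Integration.integrable_bound)
  show "integrable M (\<lambda>\<omega>. exp (b * Y \<omega>) / b + exp (a * Y \<omega>) / (- a))" using assms by simp
  show "AE \<omega> in M. norm (Y \<omega>) \<le> norm (exp (b * Y \<omega>) / b + exp (a * Y \<omega>) / (- a))"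
    using abs_le_exp_sum[OF assms(2,4)] by (intro AE_I2) (metis abs_ge_self order_trans real_norm_def)
qed simp

lemma ext_expectation_integrable:
  assumes "integrable M Y"
  shows "ext_expectation M Y = ereal (expectation Y)"
proof -
  have i: "integrable M (\<lambda>\<omega>. max 0 (Y \<omega>))" "integrable M (\<lambda>\<omega>. max 0 (- Y \<omega>))"
    using assms by auto
  have "expectation Y = (\<integral>\<omega>. max 0 (Y \<omega>) - max 0 (- Y \<omega>) \<partial>M)"
    by (intro Bochner_Integration.integral_cong) auto
  also have "\<dots> = (\<integral>\<omega>. max 0 (Y \<omega>) \<partial>M) - (\<integral>\<omega>. max 0 (- Y \<omega>) \<partial>M)"
    using i by (rule Bochner_Integration.integral_diff)
  finally have "expectation Y = (\<integral>\<omega>. max 0 (Y \<omega>) \<partial>M) - (\<integral>\<omega>. max 0 (- Y \<omega>) \<partial>M)" .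
  moreover have "(\<integral>\<^sup>+ \<omega>. ennreal (max 0 (Y \<omega>)) \<partial>M) = ennreal (\<integral>\<omega>. max 0 (Y \<omega>) \<partial>M)"
    "(\<integral>\<^sup>+ \<omega>. ennreal (max 0 (- Y \<omega>)) \<partial>M) = ennreal (\<integral>\<omega>. max 0 (- Y \<omega>) \<partial>M)"
    by (intro nn_integral_eq_integral i AE_I2; simp)+
  ultimately show ?thesis unfolding ext_expectation_def
    by (simp only:) (simp add: enn2ereal_ennreal integral_nonneg_AE)
qed

text \<open>The exponential moment at a negative parameter makes the negative part integrable, so
  failure of integrability comes from the positive part.\<close>

lemma ext_expectation_eq_infinity:
  assumes [measurable]: "Y \<in> borel_measurable M" and t: "t < 0" "integrable M (\<lambda>\<omega>. exp (t * Y \<omega>))"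
    and not_int: "\<not> integrable M Y"
  shows "ext_expectation M Y = \<infinity>"
proof -
  have neg: "integrable M (\<lambda>\<omega>. max 0 (- Y \<omega>))"
  proof (rule Bochner_Integration.integrable_bound)
    show "integrable M (\<lambda>\<omega>. exp (t * Y \<omega>) / (- t))" using t by simp
    have "max 0 (- Y \<omega>) \<le> exp (t * Y \<omega>) / (- t)" for \<omega>
    proof -
      have "t * Y \<omega> \<le> exp (t * Y \<omega>)" using exp_ge_add_one_self[of "t * Y \<omega>"] by linarith
      then have "- Y \<omega> \<le> exp (t * Y \<omega>) / (- t)" using t by (simp add: field_simps)
      moreover have "0 \<le> exp (t * Y \<omega>) / (- t)" using t by (intro divide_nonneg_pos) auto
      ultimately show ?thesis by simp
    qed
    then show "AE \<omega> in M. norm (max 0 (- Y \<omega>)) \<le> norm (exp (t * Y \<omega>) / (- t))"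
      by (intro AE_I2) (metis abs_ge_self abs_of_nonneg max.cobounded1 order_trans real_norm_def)
  qed simp
  have "(\<integral>\<^sup>+ \<omega>. ennreal (max 0 (Y \<omega>)) \<partial>M) = \<infinity>"
  proof (rule ccontr)
    assume "(\<integral>\<^sup>+ \<omega>. ennreal (max 0 (Y \<omega>)) \<partial>M) \<noteq> \<infinity>"
    then have "integrable M (\<lambda>\<omega>. max 0 (Y \<omega>))"
      by (intro integrableI_nonneg) (auto simp: less_top)
    then have "integrable M (\<lambda>\<omega>. max 0 (Y \<omega>) - max 0 (- Y \<omega>))" using neg by simp
    moreover have "(\<lambda>\<omega>. max 0 (Y \<omega>) - max 0 (- Y \<omega>)) = Y" by (auto simp: fun_eq_iff)
    ultimately show False using not_int by simp
  qed
  then show ?thesis unfolding ext_expectation_def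
    by (simp add: nn_integral_eq_integral[OF neg] enn2ereal_ennreal integral_nonneg_AE)
qed

text \<open>To the left of the mean, nonnegative parameters contribute nothing positive to the
  supremum: by Jensen if the generating function is finite, trivially otherwise. The rate is thus
  governed by the parameters for which Chernoff's bound controls the lower tail.\<close>

lemma rate_summand_nonpos:
  assumes Y: "Y \<in> borel_measurable M" and "a < 0" "integrable M (\<lambda>\<omega>. exp (a * Y \<omega>))"
    and z: "ereal z \<le> ext_expectation M Y" and t: "t \<ge> 0"
  shows "ereal (t * z) - log_mgf M Y t \<le> 0"
proof (cases "t > 0 \<and> integrable M (\<lambda>\<omega>. exp (t * Y \<omega>))")
  case True
  then have int: "integrable M Y" using integrable_of_two_sided_mgf assms by blast
  have "z \<le> expectation Y" using z ext_expectation_integrable[OF int] by simp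
  then have "exp (t * z) \<le> exp (t * expectation Y)" using t by (simp add: mult_left_mono)
  also have "\<dots> \<le> (\<integral>\<omega>. exp (t * Y \<omega>) \<partial>M)" using exp_expectation_le_mgf[OF int] True by simp
  finally have "t * z \<le> ln (\<integral>\<omega>. exp (t * Y \<omega>) \<partial>M)"
    using mgf_pos[of t Y] True by (simp add: ln_ge_iff)
  then show ?thesis using True by (simp add: log_mgf_def)
next
  case False
  then show ?thesis using t by (auto simp: log_mgf_def prob_space)
qed

lemma rate_function_ge:
  assumes "integrable M (\<lambda>\<omega>. exp (t * Y \<omega>))"
  shows "ereal (t * z - ln (\<integral>\<omega>. exp (t * Y \<omega>) \<partial>M)) \<le> rate_function M Y z"
proof -
  have "ereal (t * z - ln (\<integral>\<omega>. exp (t * Y \<omega>) \<partial>M)) = ereal (t * z) - log_mgf M Y t"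
    using assms by (simp add: log_mgf_def)
  also have "\<dots> \<le> rate_function M Y z" unfolding rate_function_def by (rule SUP_upper) simp
  finally show ?thesis .
qed

lemma ex_prob_le_gt:
  assumes [measurable]: "Y \<in> borel_measurable M" and "c < 1"
  shows "\<exists>a::real. c < prob {\<omega> \<in> space M. Y \<omega> \<le> a}"
proof -
  have "(\<lambda>n. prob {\<omega> \<in> space M. Y \<omega> \<le> real n}) \<longlonglongrightarrow> prob (\<Union>n. {\<omega> \<in> space M. Y \<omega> \<le> real n})"
    by (intro finite_Lim_measure_incseq) (auto simp: incseq_def)
  also have "(\<Union>n. {\<omega> \<in> space M. Y \<omega> \<le> real n}) = space M"
    using real_arch_simple by blast
  finally have "(\<lambda>n. prob {\<omega> \<in> space M. Y \<omega> \<le> real n}) \<longlonglongrightarrow> 1" by (simp add: prob_space)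
  then have "eventually (\<lambda>n. c < prob {\<omega> \<in> space M. Y \<omega> \<le> real n}) sequentially"
    using assms(2) by (rule order_tendstoD(1))
  then show ?thesis by (auto simp: eventually_sequentially)
qed

text \<open>A finite mean is itself a member, with rate at most zero. If the mean is infinite, a
  point \<open>a\<close> with \<open>P (Y \<le> a) > 1 / k\<close> is a member, since its rate is at
  most minus the logarithm of that probability.\<close>

lemma speed_set_nonempty:
  assumes Y [measurable]: "Y \<in> borel_measurable M" and t0: "t0 < 0" "integrable M (\<lambda>\<omega>. exp (t0 * Y \<omega>))"
    and k: "k \<ge> 2"
  shows "\<exists>z::real. ereal z \<le> ext_expectation M Y \<and> rate_function M Y z < ereal (ln (real k))"
proof -
  have lnk: "ln (real k) > 0" using k by simp
  show ?thesis
  proof (cases "integrable M Y")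
    case True
    have "rate_function M Y (expectation Y) \<le> 0" unfolding rate_function_def
    proof (rule SUP_least)
      fix t
      show "ereal (t * expectation Y) - log_mgf M Y t \<le> 0"
        using exp_expectation_le_mgf[OF True, of t] mgf_pos[of t Y]
        by (auto simp: log_mgf_def ln_ge_iff)
    qed
    also have "\<dots> < ereal (ln (real k))" using lnk by simp
    finally show ?thesis using ext_expectation_integrable[OF True] by (intro exI[of _ "expectation Y"]) simp
  next
    case False
    then have inf: "ext_expectation M Y = \<infinity>" using ext_expectation_eq_infinity[OF Y t0] by simp
    obtain a where a: "1 / real k < prob {\<omega> \<in> space M. Y \<omega> \<le> a}"
      using ex_prob_le_gt[OF Y, of "1 / real k"] k by auto
    define q where "q = prob {\<omega> \<in> space M. Y \<omega> \<le> a}"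
    have q: "q > 1 / real k" "q \<le> 1" using a by (auto simp: q_def)
    have "q > 0" using q(1) k by (auto intro: less_trans[rotated])
    have "rate_function M Y a \<le> ereal (- ln q)" unfolding rate_function_def
    proof (rule SUP_least)
      fix t
      show "ereal (t * a) - log_mgf M Y t \<le> ereal (- ln q)"
      proof (cases "t \<ge> 0")
        case True
        then have "ereal (t * a) - log_mgf M Y t \<le> 0"
          using rate_summand_nonpos[OF Y t0, of a t] inf by simp
        also have "0 \<le> ereal (- ln q)" using q \<open>q > 0\<close> by simp
        finally show ?thesis .
      next
        case False
        show ?thesis
        proof (cases "integrable M (\<lambda>\<omega>. exp (t * Y \<omega>))")
          case True
          have "(\<integral>\<omega>. indicator {\<omega> \<in> space M. Y \<omega> \<le> a} \<omega> * exp (t * a) \<partial>M) \<le> (\<integral>\<omega>. exp (t * Y \<omega>) \<partial>M)"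
            using True False
            by (intro integral_mono integrable_mult_left)
               (auto simp: emeasure_eq_measure split: split_indicator intro!: integrable_real_indicator)
          then have "q * exp (t * a) \<le> (\<integral>\<omega>. exp (t * Y \<omega>) \<partial>M)" by (simp add: q_def)
          then have "ln (q * exp (t * a)) \<le> ln (\<integral>\<omega>. exp (t * Y \<omega>) \<partial>M)"
            using \<open>q > 0\<close> mgf_pos[OF True] by simp
          then show ?thesis using True \<open>q > 0\<close> by (simp add: log_mgf_def ln_mult)
        qed (simp add: log_mgf_def)
      qed
    qed
    also have "ereal (- ln q) < ereal (ln (real k))"
    proof -
      have "ln (1 / real k) < ln q" using q(1) \<open>q > 0\<close> k by (subst ln_less_cancel_iff) auto
      then show ?thesis using k by (simp add: ln_div)
    qed
    finally show ?thesis using inf by (intro exI[of _ a]) simp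
  qed
qed

text \<open>The single finite parameter \<open>t0\<close> bounds the defining set below, so the
  infimum is genuine. A point below it is still at most the mean, hence can be outside the set only
  because its rate is at least \<open>ln k\<close>.\<close>

lemma brw_speed_minus:
  assumes Y: "Y \<in> borel_measurable M" and t0: "t0 < 0" "integrable M (\<lambda>\<omega>. exp (t0 * Y \<omega>))"
    and k: "k \<ge> 2" and e: "e > 0"
  shows "ereal (brw_speed k M Y - e) \<le> ext_expectation M Y"
    and "ereal (ln (real k)) \<le> rate_function M Y (brw_speed k M Y - e)"
proof -
  define S where "S = {z::real. ereal z \<le> ext_expectation M Y \<and> rate_function M Y z < ereal (ln (real k))}"
  define l where "l = ln (\<integral>\<omega>. exp (t0 * Y \<omega>) \<partial>M)"
  have "(ln (real k) + l) / t0 \<le> z" if "z \<in> S" for z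
  proof -
    have "ereal (t0 * z - l) \<le> rate_function M Y z" unfolding l_def by (rule rate_function_ge[OF t0(2)])
    also have "\<dots> < ereal (ln (real k))" using that by (simp add: S_def)
    finally show ?thesis using t0(1) by (simp add: field_simps)
  qed
  then have bdd: "bdd_below S" by (auto simp: bdd_below_def)
  obtain z where z: "z \<in> S" using speed_set_nonempty[OF Y t0 k] by (auto simp: S_def)
  have speed: "brw_speed k M Y = Inf S" by (simp add: brw_speed_def S_def)
  have "Inf S \<le> z" using z bdd by (rule cInf_lower)
  then have "ereal (Inf S - e) \<le> ereal z" using e by simp
  also have "\<dots> \<le> ext_expectation M Y" using z by (simp add: S_def)
  finally show le: "ereal (brw_speed k M Y - e) \<le> ext_expectation M Y" by (simp add: speed)
  have "brw_speed k M Y - e \<notin> S" using cInf_lower[OF _ bdd, of "Inf S - e"] e by (auto simp: speed)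
  then show "ereal (ln (real k)) \<le> rate_function M Y (brw_speed k M Y - e)"
    using le by (auto simp: S_def)
qed

end

subsection \<open>Bounds for the minimum\<close>

context branching_random_walk
begin

lemma iid_on_path:
  assumes "w \<in> words k"
  shows "indep_vars (\<lambda>_. borel) X (nonempty_prefixes w)"
    and "\<And>v. v \<in> nonempty_prefixes w \<Longrightarrow> distr M borel (X v) = distr N borel Y"
  using indep_vars_subset[OF indep nonempty_prefixes_subset_words[OF assms]]
    nonempty_prefixes_subset_words[OF assms] distr_displacement by auto

lemma prob_path_le_chernoff:
  assumes w: "w \<in> level k m" and Y: "Y \<in> borel_measurable N"
    and int: "integrable N (\<lambda>\<omega>. exp (t * Y \<omega>))" and t: "t \<le> 0"
  shows "prob (path_le w (z * real m)) \<le> exp (- (t * z)) ^ m * (\<integral>\<omega>. exp (t * Y \<omega>) \<partial>N) ^ m"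
proof -
  have w': "w \<in> words k" "length w = m" using w by (auto simp: level_def)
  let ?P = "\<lambda>\<omega>. \<Prod>v\<in>nonempty_prefixes w. exp (t * X v \<omega>)"
  have iP: "integrable M ?P" and eP: "(\<integral>\<omega>. ?P \<omega> \<partial>M) = (\<integral>\<omega>. exp (t * Y \<omega>) \<partial>N) ^ m"
    using iid_prod_expectation[OF finite_nonempty_prefixes iid_on_path[OF w'(1)] Y _ int]
    by (simp_all add: card_nonempty_prefixes w')
  have "prob (path_le w (z * real m)) = (\<integral>\<omega>. indicator (path_le w (z * real m)) \<omega> \<partial>M)"
    using path_le_in_events[OF w'(1)] sets.sets_into_space by (simp add: Int_absorb2)
  also have "\<dots> \<le> (\<integral>\<omega>. exp (- (t * z)) ^ m * ?P \<omega> \<partial>M)"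
  proof (intro integral_mono)
    fix \<omega>
    define S where "S = (\<Sum>v\<in>nonempty_prefixes w. X v \<omega>)"
    have eq: "exp (- (t * z)) ^ m * ?P \<omega> = exp (t * (S - z * m))"
      unfolding S_def by (simp add: exp_sum[symmetric] sum_distrib_left[symmetric]
          exp_of_nat_mult[symmetric] algebra_simps flip: exp_add)
    show "indicator (path_le w (z * real m)) \<omega> \<le> exp (- (t * z)) ^ m * ?P \<omega>"
      unfolding eq using t by (auto simp: path_le_def S_def mult_nonpos_nonpos split: split_indicator)
  qed (use iP path_le_in_events[OF w'(1)] in \<open>auto simp: emeasure_eq_measure intro!: integrable_real_indicator\<close>)
  also have "\<dots> = exp (- (t * z)) ^ m * (\<integral>\<omega>. exp (t * Y \<omega>) \<partial>N) ^ m" by (simp add: eP)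
  finally show ?thesis .
qed

text \<open>The union bound and Chernoff's inequality, solved for the rate. In this form an infinite
  rate needs no special treatment: it simply contradicts positivity of the probability.\<close>

lemma prob_subtree_le_upper:
  assumes N: "prob_space N" and Y: "Y \<in> borel_measurable N"
    and t0: "t0 < 0" "integrable N (\<lambda>\<omega>. exp (t0 * Y \<omega>))"
    and z: "ereal z \<le> ext_expectation N Y" and m: "m \<ge> 1"
    and P: "prob (subtree_le [] m (z * real m)) > 0"
  shows "rate_function N Y z \<le> ereal (ln (real k) - ln (prob (subtree_le [] m (z * real m))) / m)"
  unfolding rate_function_def
proof (rule SUP_least)
  interpret N: prob_space N by fact
  define P where "P = prob (subtree_le [] m (z * real m))"
  have P0: "P > 0" using P by (simp add: P_def)
  fix t
  show "ereal (t * z) - log_mgf N Y t \<le> ereal (ln (real k) - ln P / m)"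
  proof (cases "t \<ge> 0")
    case True
    have "ereal (t * z) - log_mgf N Y t \<le> 0" by (rule N.rate_summand_nonpos[OF Y t0 z True])
    \<comment> \<open>For nonnegative parameters it is enough that the right-hand side is
      nonnegative, as \<open>P\<close> is at most one.\<close>
    also have "ln (real k) \<ge> 0" "ln P \<le> 0" using k_pos P0 by (auto simp: P_def)
    then have "0 \<le> ereal (ln (real k) - ln P / m)" using m by (simp add: divide_le_0_iff order_trans[of _ 0])
    finally show ?thesis .
  next
    case False
    show ?thesis
    proof (cases "integrable N (\<lambda>\<omega>. exp (t * Y \<omega>))")
      case True
      define \<phi> where "\<phi> = (\<integral>\<omega>. exp (t * Y \<omega>) \<partial>N)"
      have \<phi>: "\<phi> > 0" unfolding \<phi>_def by (rule N.mgf_pos[OF True])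
      have "P \<le> (\<Sum>u\<in>level k m. prob (path_le u (z * real m)))"
        unfolding P_def subtree_le_Nil_eq_UN
        by (intro finite_measure_subadditive_finite finite_level)
           (auto intro!: path_le_in_events simp: level_def)
      also have "\<dots> \<le> (\<Sum>u\<in>level k m. exp (- (t * z)) ^ m * \<phi> ^ m)"
        unfolding \<phi>_def using False by (intro sum_mono prob_path_le_chernoff Y True) auto
      also have "\<dots> = (real k * exp (- (t * z)) * \<phi>) ^ m"
        by (simp add: card_level power_mult_distrib)
      finally have "ln P \<le> ln ((real k * exp (- (t * z)) * \<phi>) ^ m)"
        using P0 k_pos \<phi> by (subst ln_le_cancel_iff) auto
      also have "\<dots> = m * (ln (real k) - t * z + ln \<phi>)"
        using k_pos \<phi> by (simp add: ln_realpow ln_mult)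
      finally have "ln P / m \<le> ln (real k) - t * z + ln \<phi>" using m by (simp add: field_simps)
      then show ?thesis using True by (simp add: log_mgf_def \<phi>_def)
    qed (simp add: log_mgf_def)
  qed
qed

lemma prob_subtree_le_lower:
  assumes N: "prob_space N" and Y [measurable]: "Y \<in> borel_measurable N"
    and i: "rate_function N Y z = ereal i" and lnk: "ln (real k) \<le> i" and \<delta>: "\<delta> > 0"
  shows "\<exists>c>0. \<forall>m. c * (real k * exp (- (i + \<delta>))) ^ m \<le> prob (subtree_le [] m (z * real m))"
proof -
  interpret N: prob_space N by fact
  define W where "W = (\<lambda>\<omega>. Y \<omega> - z)"
  have W [measurable]: "W \<in> borel_measurable N" unfolding W_def by measurable
  \<comment> \<open>Half of \<delta> pays for the strict inequality in Cramer's bound; the other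
    half gives the gap needed by the recursion.\<close>
  define r where "r = exp (- (i + \<delta> / 2))"
  have r: "r > 0" by (simp add: r_def)
  have gt: "(\<integral>\<omega>. exp (t * W \<omega>) \<partial>N) > r" if int: "integrable N (\<lambda>\<omega>. exp (t * W \<omega>))" for t
  proof -
    have eq: "exp (t * Y \<omega>) = exp (t * z) * exp (t * W \<omega>)" for \<omega>
      by (simp add: W_def algebra_simps flip: exp_add)
    have iY: "integrable N (\<lambda>\<omega>. exp (t * Y \<omega>))" unfolding eq using int by simp
    have "t * z - ln (\<integral>\<omega>. exp (t * Y \<omega>) \<partial>N) \<le> i" using N.rate_function_ge[OF iY, of z] i by simp
    also have "ln (\<integral>\<omega>. exp (t * Y \<omega>) \<partial>N) = t * z + ln (\<integral>\<omega>. exp (t * W \<omega>) \<partial>N)"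
      unfolding eq using N.mgf_pos[OF int] by (simp add: ln_mult)
    finally have "ln (\<integral>\<omega>. exp (t * W \<omega>) \<partial>N) > - (i + \<delta> / 2)" using \<delta> by simp
    then show ?thesis unfolding r_def using N.mgf_pos[OF int] by (metis exp_less_cancel_iff exp_ln)
  qed
  obtain L where L: "L \<ge> 1" and cramer: "\<And>I (V :: nat list \<Rightarrow> 'a \<Rightarrow> real). finite I \<Longrightarrow> card I = L \<Longrightarrow>
      indep_vars (\<lambda>_. borel) V I \<Longrightarrow> (\<forall>i\<in>I. distr M borel (V i) = distr N borel W) \<Longrightarrow>
      r ^ L \<le> prob {\<omega> \<in> space M. (\<Sum>i\<in>I. V i \<omega>) \<le> 0}"
    using cramer_lower_bound[OF N W r gt prob_space_axioms] by blast
  have path: "r ^ L \<le> prob (path_le w (z * real L))" if w: "w \<in> level k L" for w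
  proof -
    have w': "w \<in> words k" "length w = L" using w by (auto simp: level_def)
    have "r ^ L \<le> prob {\<omega> \<in> space M. (\<Sum>v\<in>nonempty_prefixes w. X v \<omega> - z) \<le> 0}"
    proof (rule cramer)
      show "indep_vars (\<lambda>_. borel) (\<lambda>v \<omega>. X v \<omega> - z) (nonempty_prefixes w)"
        by (rule indep_vars_compose2[OF iid_on_path(1)[OF w'(1)]]) simp
      show "\<forall>v\<in>nonempty_prefixes w. distr M borel (\<lambda>\<omega>. X v \<omega> - z) = distr N borel W"
      proof
        fix v assume v: "v \<in> nonempty_prefixes w"
        then have [measurable]: "X v \<in> borel_measurable M"
          using nonempty_prefixes_subset_words[OF w'(1)] measurable_displacement by auto
        have "distr M borel (\<lambda>\<omega>. X v \<omega> - z) = distr (distr M borel (X v)) borel (\<lambda>x. x - z)"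
          by (subst distr_distr) (auto simp: comp_def)
        also have "\<dots> = distr N borel W"
          unfolding iid_on_path(2)[OF w'(1) v] W_def by (subst distr_distr) (auto simp: comp_def)
        finally show "distr M borel (\<lambda>\<omega>. X v \<omega> - z) = distr N borel W" .
      qed
    qed (use w' in \<open>auto simp: card_nonempty_prefixes\<close>)
    also have "{\<omega> \<in> space M. (\<Sum>v\<in>nonempty_prefixes w. X v \<omega> - z) \<le> 0} = path_le w (z * real L)"
      by (simp add: path_le_def sum_subtractf card_nonempty_prefixes w' mult.commute)
    finally show ?thesis .
  qed
  define p where "p m = prob (subtree_le [] m (z * real m))" for m
  have p_add: "subtree_le [] (l + m) (z * real (l + m)) = subtree_le [] (l + m) (z * real l + z * real m)" for l m
    by (simp add: algebra_simps)
  define w where "w = [1::nat]"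
  have w: "w \<in> level k 1" "w \<in> words k" "w \<noteq> []" "nonempty_prefixes w = {w}"
    using k_pos by (simp_all add: w_def level_def words_def nonempty_prefixes_eq_image)
  \<comment> \<open>If a step never went to \<open>z\<close> or below, \<open>W\<close> would be
    positive almost surely and the bound for nonnegative variables would give
    \<open>r \<le> 0\<close>.\<close>
  have step_pos: "prob (path_le w z) > 0"
  proof -
    have [measurable]: "X w \<in> borel_measurable M" using w by (intro measurable_displacement)
    have "prob (path_le w z) = measure (distr M borel (X w)) {..z}"
      unfolding path_le_def w(4) by (subst measure_distr) (auto intro!: arg_cong[where f = prob])
    also have "\<dots> = N.prob {\<omega> \<in> space N. W \<omega> \<le> 0}"
      unfolding distr_displacement[OF w(2,3)] W_def
      by (subst measure_distr) (auto intro!: arg_cong[where f = N.prob])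
    finally have eq: "prob (path_le w z) = N.prob {\<omega> \<in> space N. W \<omega> \<le> 0}" .
    have "N.prob {\<omega> \<in> space N. W \<omega> \<le> 0} \<noteq> 0"
    proof
      assume 0: "N.prob {\<omega> \<in> space N. W \<omega> \<le> 0} = 0"
      have "N.prob {\<omega> \<in> space N. W \<omega> < 0} \<le> N.prob {\<omega> \<in> space N. W \<omega> \<le> 0}"
        by (intro N.finite_measure_mono) auto
      with 0 have "N.prob {\<omega> \<in> space N. W \<omega> < 0} = 0" by (simp add: measure_le_0_iff)
      from N.prob_nonpos_ge_of_nonneg[OF W this gt] 0 r show False by simp
    qed
    then show ?thesis unfolding eq by (simp add: zero_less_measure_iff)
  qed
  have p_pos: "p m > 0" for m
  proof (induction m)
    case 0
    show ?case by (simp add: p_def subtree_le_def prob_space)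
  next
    case (Suc m)
    have "0 < prob (path_le w z) * p m" using Suc step_pos by simp
    also have "\<dots> \<le> p (Suc m)"
      using prob_subtree_le_add_ge[OF w(1), where c = z and m = m and d = "z * real m"] p_add[of 1 m] by (simp add: p_def)
    finally show ?case .
  qed
  have "\<exists>c>0. \<forall>m. p m \<ge> c * (real k * exp (- (i + \<delta>))) ^ m"
  \<comment> \<open>The recursion is used with \<open>\<mu> = k ^ L * r ^ L\<close>,
    \<open>B = (k ^ L)\<^sup>2\<close>, \<open>q = r ^ L\<close> and ratio
    \<open>k * exp (- (i + \<delta>))\<close>, which is at most one because
    \<open>ln k \<le> i\<close>.\<close>
  proof (rule geometric_lower_bound[OF L])
    show "p m > 0" for m by (rule p_pos)
    show "0 < real k * exp (- (i + \<delta>))" using k_pos by simp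
    have "real k * exp (- (i + \<delta>)) = exp (ln (real k) - (i + \<delta>))"
      using k_pos by (simp only: exp_diff exp_minus exp_ln of_nat_0_less_iff divide_inverse)
    also have "\<dots> \<le> 1" using lnk \<delta> by simp
    finally show "real k * exp (- (i + \<delta>)) \<le> 1" .
    have "real k * exp (- (i + \<delta>)) < real k * r" using k_pos \<delta> by (simp add: r_def)
    then have "(real k * exp (- (i + \<delta>))) ^ L < (real k * r) ^ L"
      using L by (intro power_strict_mono) auto
    then show "(real k * exp (- (i + \<delta>))) ^ L < real k ^ L * r ^ L" by (simp add: power_mult_distrib)
    show "(real k ^ L)\<^sup>2 > 0" using k_pos by simp
    show "r ^ L > 0" using r by simp
    show "p (L + m) \<ge> r ^ L * p m" for m
    proof -
      obtain w where w: "w \<in> level k L" using level_nonempty by blast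
      have "r ^ L * p m \<le> prob (path_le w (z * real L)) * p m"
        using path[OF w] p_pos[of m] by (intro mult_right_mono) auto
      also have "\<dots> \<le> p (L + m)" unfolding p_def p_add by (rule prob_subtree_le_add_ge[OF w])
      finally show ?thesis .
    qed
    show "p (L + m) \<ge> real k ^ L * r ^ L * p m - (real k ^ L)\<^sup>2 * (p m)\<^sup>2" for m
      using prob_subtree_le_add_ge_quadratic[OF path, where m = m and d = "z * real m"]
      unfolding p_def p_add by (simp add: power_mult_distrib)
  qed
  then show ?thesis by (simp add: p_def)
qed

end

theorem theorem3p3:
  fixes k :: nat and N :: "'b measure" and Y :: "'b \<Rightarrow> real"
    and M :: "'a measure" and X :: "nat list \<Rightarrow> 'a \<Rightarrow> real"
    and \<epsilon> \<delta> \<gamma> :: real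
  assumes "k \<ge> 2"
    and "prob_space N"
    and "Y \<in> borel_measurable N"
    and "\<exists>\<theta><0. integrable N (\<lambda>\<omega>. exp (\<theta> * Y \<omega>))"
    and "brw_displacements k N Y M X"
    and "\<epsilon> > 0"
    and "\<gamma> = brw_speed k N Y"
    and "\<delta> > 0"
  shows "\<exists>c c' :: real. c > 0 \<and> c' > 0 \<and>
    (\<forall>m::nat. m \<ge> 1 \<longrightarrow>
      ereal (c * real k ^ m) * exp_ereal (- (ereal (real m) * (rate_function N Y (\<gamma> - \<epsilon>) + ereal \<delta>)))
        \<le> ereal (measure M {\<omega> \<in> space M. brw_min k X m \<omega> \<le> (\<gamma> - \<epsilon>) * real m}) \<and>
      ereal (measure M {\<omega> \<in> space M. brw_min k X m \<omega> \<le> (\<gamma> - \<epsilon>) * real m})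
        \<le> ereal (c' * real k ^ m) * exp_ereal (- (ereal (real m) * rate_function N Y (\<gamma> - \<epsilon>))))"
proof -
  interpret N: prob_space N by fact
  interpret M: prob_space M using assms(5) by (simp add: brw_displacements_def)
  interpret branching_random_walk M k N Y X
    using assms(1,5) by unfold_locales auto
  obtain \<theta> where \<theta>: "\<theta> < 0" "integrable N (\<lambda>\<omega>. exp (\<theta> * Y \<omega>))" using assms(4) by blast
  define z where "z = \<gamma> - \<epsilon>"
  define I where "I = rate_function N Y z"
  define p where "p m = M.prob (subtree_le [] m (z * real m))" for m
  have z: "ereal z \<le> ext_expectation N Y" and lnk: "ereal (ln (real k)) \<le> I"
    using N.brw_speed_minus[OF assms(3) \<theta> assms(1,6)] by (simp_all add: z_def I_def assms(7))
  have event: "M.prob {\<omega> \<in> space M. brw_min k X m \<omega> \<le> z * real m} = p m" for m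
    by (simp add: p_def brw_min_le_eq)
  have upper: "I \<le> ereal (ln (real k) - ln (p m) / m)" if "m \<ge> 1" "p m > 0" for m
    using prob_subtree_le_upper[OF assms(2,3) \<theta> z that(1)] that(2) by (simp add: p_def I_def)
  have exp_mult: "exp (- (real m * x)) = exp (- x) ^ m" for m x
    by (simp add: exp_of_nat_mult[symmetric])
  \<comment> \<open>The upper constant is \<open>1\<close>, since the union bound loses no
    factor.\<close>
  have "\<exists>c>0. \<forall>m\<ge>1. ereal (c * real k ^ m) * exp_ereal (- (ereal (real m) * (I + ereal \<delta>))) \<le> ereal (p m)
      \<and> ereal (p m) \<le> ereal (1 * real k ^ m) * exp_ereal (- (ereal (real m) * I))"
  proof (cases I)
    case (real i)
    obtain c where c: "c > 0" "\<And>m. c * (real k * exp (- (i + \<delta>))) ^ m \<le> p m"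
      using prob_subtree_le_lower[OF assms(2,3) _ _ assms(8), of z i] lnk real by (auto simp: I_def p_def)
    show ?thesis
    proof (intro exI[of _ c] conjI allI impI)
      fix m :: nat assume m: "m \<ge> 1"
      show "ereal (c * real k ^ m) * exp_ereal (- (ereal (real m) * (I + ereal \<delta>))) \<le> ereal (p m)"
        using c(2)[of m] unfolding real by (simp add: exp_ereal_def exp_mult power_mult_distrib mult.assoc)
      have "p m \<le> real k ^ m * exp (- (m * i))"
      proof (cases "p m > 0")
        case True
        have "ln (p m) \<le> m * (ln (real k) - i)" using upper[OF m True] m real by (simp add: field_simps)
        then have "p m \<le> exp (m * (ln (real k) - i))" using True by (metis exp_le_cancel_iff exp_ln)
        also have "\<dots> = real k ^ m * exp (- (m * i))"
          using k_pos by (simp add: right_diff_distrib exp_diff exp_of_nat_mult exp_minus field_simps)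
        finally show ?thesis .
      next
        case False
        then have "p m \<le> 0" by simp
        also have "0 \<le> real k ^ m * exp (- (m * i))" by simp
        finally show ?thesis .
      qed
      then show "ereal (p m) \<le> ereal (1 * real k ^ m) * exp_ereal (- (ereal (real m) * I))"
        unfolding real by (simp add: exp_ereal_def)
    qed (rule c(1))
  next
    \<comment> \<open>Both exponential factors are \<open>0\<close> by the convention in
      \<open>exp_ereal\<close>. The lower bound is then trivial, and the upper bound says that
      \<open>p m\<close> vanishes.\<close>
    case PInf
    show ?thesis
    proof (intro exI[of _ 1] conjI allI impI)
      fix m :: nat assume m: "m \<ge> 1"
      show "ereal (1 * real k ^ m) * exp_ereal (- (ereal (real m) * (I + ereal \<delta>))) \<le> ereal (p m)"
        using m by (simp add: PInf exp_ereal_def p_def)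
      have "\<not> p m > 0" using upper[OF m] PInf by auto
      then show "ereal (p m) \<le> ereal (1 * real k ^ m) * exp_ereal (- (ereal (real m) * I))"
        using m by (simp add: PInf exp_ereal_def)
    qed simp
  next
    case MInf
    then show ?thesis using lnk by simp
  qed
  then show ?thesis unfolding z_def[symmetric] I_def[symmetric] event by (metis zero_less_one)
qed

end
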